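(* Let $f=\mathrm{span}\{s^+,s^-\}$ be an $\Omega$-surface with enveloped isothermic sphere congruences $s^\pm$ that separate the curvature spheres harmonically, given by aligned Moutard lifts. The Calapso transformations $T^\pm$ of $s^\pm$ yield the Lie geometric deformation $\lambda\mapsto T(\lambda)f$ of $f$ as a Lie deformable surface: for suitable choices of the constants of integration (for each $\lambda\in\mathbb{R}$), $$T(\lambda)f=T^+(\lambda)f=T^-(\lambda)f .$$
   Context: Lie sphere geometry. $\mathbb{R}^{4,2}$ is $\mathbb{R}^6$ with an inner product $(\cdot,\cdot)$ of signature $(4,2)$. An (oriented) sphere is a null line in $\mathbb{R}^{4,2}$, usually represented by a non-zero null vector. A contact element is a null 2-plane. A Legendre map is a smooth map $f$ from a surface $M^2$ into the null 2-planes with $(ds,s')=0$ for all sections $s,s'$ of $f$ and such that, at each point, $d_Xs\in f$ for all sections $s$ of $f$ only if $X=0$. It envelops a sphere congruence $s$ if $s\in f$ pointwise. A curvature sphere is a null line in $f$ spanned by a section $s_i$ of $f$ with $d_Xs_i\in f$ for some $X\neq0$. We assume that $f$ has two distinct curvature spheres $s_1,s_2$ at every point; $(u,v)$ are curvature line coordinates if $s_{1u},s_{2v}\in f$. Two enveloped sphere congruences $s^\pm$ spanning $f$ separate the curvature spheres harmonically if the cross ratio of the pairs $s^+,s^-$ and $s_1,s_2$ on the projective line $P(f)$ equals $-1$. An enveloped sphere congruence $s$ is isothermic if in curvature line coordinates it admits a Moutard lift, i.e., a representative with $s_{uv}\parallel s$, that is $s\wedge s_{uv}=0$. An $\Omega$-surface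 is such a Legendre map that envelops a pair of isothermic sphere congruences $s^\pm$ separating the curvature spheres harmonically. The considerations are local: $M^2$ is assumed to be simply connected with global curvature line coordinates $(u,v)$. The Moutard lifts $s^\pm$ are called aligned if $s^\pm=s_1\pm s_2$ for suitable lifts $s_1,s_2$ of the curvature spheres; such aligned Moutard lifts always exist, and they satisfy $s_1\wedge s_{2v}=s_2\wedge s_{1u}=0$. For $a,b\in\mathbb{R}^{4,2}$, $a\wedge b\in\mathfrak{o}(4,2)$ denotes the skew endomorphism $(a\wedge b)c=(a,c)b-(b,c)a$. The operator $\star$ on 1-forms is given by $\star du=du$, $\star dv=-dv$. The Calapso transformations of $s^\pm$ are the maps $T^\pm(\lambda):M^2\to O(4,2)$, $\lambda\in\mathbb{R}$, with $$dT^\pm(\lambda)=T^\pm(\lambda)\,\lambda\tau^\pm,\qquad \tau^\pm:=s^\pm\wedge\star ds^\pm ,$$ unique up to left multiplication by a constant (in $M$) element of $O(4,2)$. With $$\tau:=\tau^++\tfrac12 d(s^+\wedge s^-)=\tau^-+\tfrac12 d(s^-\wedge s^+),$$ let $T(\lambda):M^2\to O(4,2)$ be a solution of $dT(\lambda)=T(\lambda)\,\lambda\tau$, also unique up to left multiplication by a constant element of $O(4,2)$. The family $\lambda\mapsto f(\lambda)=T(\lambda)f$ is the Lie geometric deformation of $f$. *)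

theory Defs
  imports "HOL-Analysis.Analysis"
begin

section \<open>The space \<open>\<real>\<^sup>6\<close> with an inner product of signature (4,2)\<close>

definition signature_4_2 :: "(real^6 \<Rightarrow> real^6 \<Rightarrow> real) \<Rightarrow> bool" where
  "signature_4_2 B \<longleftrightarrow> bilinear B \<and> (\<forall>x y. B x y = B y x) \<and>
     (\<exists>e :: 6 \<Rightarrow> real^6. (\<forall>i j. i \<noteq> j \<longrightarrow> B (e i) (e j) = 0) \<and>
        card {i. B (e i) (e i) = 1} = 4 \<and> card {i. B (e i) (e i) = -1} = 2)"

text \<open>Since a form of signature (4,2) is nondegenerate and the dimension is finite, the linear maps
  preserving it are automatically invertible.\<close>

definition orth_group :: "(real^6 \<Rightarrow> real^6 \<Rightarrow> real) \<Rightarrow> ((real^6) \<Rightarrow>\<^sub>L (real^6)) set" where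
  "orth_group B = {A. \<forall>x y. B (blinfun_apply A x) (blinfun_apply A y) = B x y}"

definition wedge :: "(real^6 \<Rightarrow> real^6 \<Rightarrow> real) \<Rightarrow> real^6 \<Rightarrow> real^6 \<Rightarrow> ((real^6) \<Rightarrow>\<^sub>L (real^6))" where
  "wedge B a b = Blinfun (\<lambda>c. B a c *\<^sub>R b - B b c *\<^sub>R a)"

lemma wedge_apply:
  assumes "bilinear B"
  shows "blinfun_apply (wedge B a b) c = B a c *\<^sub>R b - B b c *\<^sub>R a"
proof -
  have "linear (\<lambda>c. B a c *\<^sub>R b - B b c *\<^sub>R a)"
    using assms by (auto intro!: linearI
        simp: bilinear_radd bilinear_rmul algebra_simps)
  then have "bounded_linear (\<lambda>c. B a c *\<^sub>R b - B b c *\<^sub>R a)"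
    by (rule linear_conv_bounded_linear[THEN iffD1])
  then show ?thesis
    by (simp add: wedge_def bounded_linear_Blinfun_apply)
qed

section \<open>Calculus in the coordinates (u,v)\<close>

text \<open>A surface with global coordinates (u,v) is identified with an open set of
  \<open>\<real> \<times> \<real>\<close>. A 1-form \<open>\<omega>\<close> takes a point \<open>p\<close> and a tangent vector \<open>X\<close>.\<close>

definition ext_deriv ::
  "(real \<times> real \<Rightarrow> 'a::real_normed_vector) \<Rightarrow> real \<times> real \<Rightarrow> real \<times> real \<Rightarrow> 'a" where
  "ext_deriv g p X = frechet_derivative g (at p) X"

definition partial_u ::
  "(real \<times> real \<Rightarrow> 'a::real_normed_vector) \<Rightarrow> real \<times> real \<Rightarrow> 'a" where
  "partial_u g p = ext_deriv g p (1, 0)"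

definition partial_v ::
  "(real \<times> real \<Rightarrow> 'a::real_normed_vector) \<Rightarrow> real \<times> real \<Rightarrow> 'a" where
  "partial_v g p = ext_deriv g p (0, 1)"

fun Ck_on :: "nat \<Rightarrow> (real \<times> real) set \<Rightarrow> (real \<times> real \<Rightarrow> 'a::real_normed_vector) \<Rightarrow> bool" where
  "Ck_on 0 U g \<longleftrightarrow> continuous_on U g"
| "Ck_on (Suc k) U g \<longleftrightarrow>
     (\<forall>p\<in>U. g differentiable (at p)) \<and> Ck_on k U (partial_u g) \<and> Ck_on k U (partial_v g)"

definition smooth_on :: "(real \<times> real) set \<Rightarrow> (real \<times> real \<Rightarrow> 'a::real_normed_vector) \<Rightarrow> bool" where
  "smooth_on U g \<longleftrightarrow> (\<forall>k. Ck_on k U g)"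

text \<open>The linear extension of \<open>\<star>du = du\<close>, \<open>\<star>dv = -dv\<close>.\<close>

definition star_form ::
  "(real \<times> real \<Rightarrow> real \<times> real \<Rightarrow> 'a) \<Rightarrow> real \<times> real \<Rightarrow> real \<times> real \<Rightarrow> 'a" where
  "star_form \<omega> p X = \<omega> p (fst X, - snd X)"

section \<open>Legendre maps and curvature spheres\<close>

definition null_plane :: "(real^6 \<Rightarrow> real^6 \<Rightarrow> real) \<Rightarrow> (real^6) set \<Rightarrow> bool" where
  "null_plane B P \<longleftrightarrow> subspace P \<and> dim P = 2 \<and> (\<forall>x\<in>P. \<forall>y\<in>P. B x y = 0)"

definition section_over ::
  "(real \<times> real \<Rightarrow> (real^6) set) \<Rightarrow> (real \<times> real) set \<Rightarrow> (real \<times> real \<Rightarrow> real^6) \<Rightarrow> bool" where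
  "section_over f V s \<longleftrightarrow> smooth_on V s \<and> (\<forall>p\<in>V. s p \<in> f p)"

text \<open>The second conjunct is smoothness of \<open>f\<close> as a map into the Grassmannian; sections are
  taken over arbitrary open subsets.\<close>

definition legendre_map ::
  "(real^6 \<Rightarrow> real^6 \<Rightarrow> real) \<Rightarrow> (real \<times> real) set \<Rightarrow> (real \<times> real \<Rightarrow> (real^6) set) \<Rightarrow> bool" where
  "legendre_map B U f \<longleftrightarrow>
     (\<forall>p\<in>U. null_plane B (f p)) \<and>
     (\<forall>p\<in>U. \<exists>V s s'. open V \<and> p \<in> V \<and> V \<subseteq> U \<and> smooth_on V s \<and> smooth_on V s' \<and>
        (\<forall>q\<in>V. f q = span {s q, s' q})) \<and>
     (\<forall>V s s'. open V \<and> V \<subseteq> U \<and> section_over f V s \<and> section_over f V s' \<longrightarrow>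
        (\<forall>p\<in>V. \<forall>X. B (ext_deriv s p X) (s' p) = 0)) \<and>
     (\<forall>p\<in>U. \<forall>X.
        (\<forall>V s. open V \<and> p \<in> V \<and> V \<subseteq> U \<and> section_over f V s \<longrightarrow> ext_deriv s p X \<in> f p)
        \<longrightarrow> X = 0)"

definition curvature_sphere_at ::
  "(real \<times> real) set \<Rightarrow> (real \<times> real \<Rightarrow> (real^6) set) \<Rightarrow> real \<times> real \<Rightarrow> (real^6) set \<Rightarrow> bool" where
  "curvature_sphere_at U f p L \<longleftrightarrow>
     (\<exists>V s X. open V \<and> p \<in> V \<and> V \<subseteq> U \<and> section_over f V s \<and> s p \<noteq> 0 \<and> L = span {s p} \<and>
        X \<noteq> 0 \<and> ext_deriv s p X \<in> f p)"

text \<open>A sphere congruence is given by a nowhere vanishing representative; that its values are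
  null vectors is part of \<open>f\<close> consisting of null planes.\<close>

definition envelops ::
  "(real \<times> real) set \<Rightarrow> (real \<times> real \<Rightarrow> (real^6) set) \<Rightarrow> (real \<times> real \<Rightarrow> real^6) \<Rightarrow> bool" where
  "envelops U f s \<longleftrightarrow> section_over f U s \<and> (\<forall>p\<in>U. s p \<noteq> 0)"

text \<open>\<open>s1\<close>, \<open>s2\<close> are lifts of the two distinct curvature spheres, and the
  coordinates (u,v) are curvature line coordinates.\<close>

definition curvature_line_lifts ::
  "(real \<times> real) set \<Rightarrow> (real \<times> real \<Rightarrow> (real^6) set) \<Rightarrow>
   (real \<times> real \<Rightarrow> real^6) \<Rightarrow> (real \<times> real \<Rightarrow> real^6) \<Rightarrow> bool" where
  "curvature_line_lifts U f s1 s2 \<longleftrightarrow>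
     envelops U f s1 \<and> envelops U f s2 \<and>
     (\<forall>p\<in>U. curvature_sphere_at U f p (span {s1 p}) \<and> curvature_sphere_at U f p (span {s2 p}) \<and>
        span {s1 p} \<noteq> span {s2 p} \<and>
        partial_u s1 p \<in> f p \<and> partial_v s2 p \<in> f p)"

section \<open>Omega surfaces\<close>

text \<open>Cross ratio of the points \<open>a, b\<close> and \<open>c, d\<close> of a projective line, for linearly
  independent \<open>a, b\<close>: if \<open>c = \<alpha> a + \<beta> b\<close> and \<open>d = \<gamma> a + \<delta> b\<close>, it is
  \<open>\<beta> \<gamma> / (\<alpha> \<delta>) = [a,c] [b,d] / ([b,c] [a,d])\<close> with any area form \<open>[ , ]\<close>.\<close>

definition cross_ratio :: "real^6 \<Rightarrow> real^6 \<Rightarrow> real^6 \<Rightarrow> real^6 \<Rightarrow> real" where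
  "cross_ratio a b c d =
     (representation {a, b} c b * representation {a, b} d a) /
     (representation {a, b} c a * representation {a, b} d b)"

definition moutard_lift ::
  "(real^6 \<Rightarrow> real^6 \<Rightarrow> real) \<Rightarrow> (real \<times> real) set \<Rightarrow> (real \<times> real \<Rightarrow> real^6) \<Rightarrow> bool" where
  "moutard_lift B U s \<longleftrightarrow> (\<forall>p\<in>U. wedge B (s p) (partial_v (partial_u s) p) = 0)"

definition isothermic ::
  "(real^6 \<Rightarrow> real^6 \<Rightarrow> real) \<Rightarrow> (real \<times> real) set \<Rightarrow> (real \<times> real \<Rightarrow> (real^6) set) \<Rightarrow>
   (real \<times> real \<Rightarrow> real^6) \<Rightarrow> bool" where
  "isothermic B U f s \<longleftrightarrow> envelops U f s \<and>
     (\<exists>\<sigma>. envelops U f \<sigma> \<and> (\<forall>p\<in>U. span {\<sigma> p} = span {s p}) \<and> moutard_lift B U \<sigma>)"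

definition omega_surface ::
  "(real^6 \<Rightarrow> real^6 \<Rightarrow> real) \<Rightarrow> (real \<times> real) set \<Rightarrow> (real \<times> real \<Rightarrow> (real^6) set) \<Rightarrow>
   (real \<times> real \<Rightarrow> real^6) \<Rightarrow> (real \<times> real \<Rightarrow> real^6) \<Rightarrow> bool" where
  "omega_surface B U f sp sm \<longleftrightarrow>
     legendre_map B U f \<and>
     isothermic B U f sp \<and> isothermic B U f sm \<and>
     (\<forall>p\<in>U. f p = span {sp p, sm p}) \<and>
     (\<exists>c1 c2. curvature_line_lifts U f c1 c2 \<and>
        (\<forall>p\<in>U. cross_ratio (sp p) (sm p) (c1 p) (c2 p) = -1))"

definition aligned_moutard_lifts ::
  "(real^6 \<Rightarrow> real^6 \<Rightarrow> real) \<Rightarrow> (real \<times> real) set \<Rightarrow> (real \<times> real \<Rightarrow> (real^6) set) \<Rightarrow>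
   (real \<times> real \<Rightarrow> real^6) \<Rightarrow> (real \<times> real \<Rightarrow> real^6) \<Rightarrow> bool" where
  "aligned_moutard_lifts B U f sp sm \<longleftrightarrow>
     moutard_lift B U sp \<and> moutard_lift B U sm \<and>
     (\<exists>s1 s2. curvature_line_lifts U f s1 s2 \<and>
        (\<forall>p\<in>U. sp p = s1 p + s2 p \<and> sm p = s1 p - s2 p))"

section \<open>Calapso transformations and the Lie geometric deformation\<close>

definition tau_form ::
  "(real^6 \<Rightarrow> real^6 \<Rightarrow> real) \<Rightarrow> (real \<times> real \<Rightarrow> real^6) \<Rightarrow>
   real \<times> real \<Rightarrow> real \<times> real \<Rightarrow> ((real^6) \<Rightarrow>\<^sub>L (real^6))" where
  "tau_form B s p X = wedge B (s p) (star_form (ext_deriv s) p X)"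

definition tau_mid ::
  "(real^6 \<Rightarrow> real^6 \<Rightarrow> real) \<Rightarrow> (real \<times> real \<Rightarrow> real^6) \<Rightarrow> (real \<times> real \<Rightarrow> real^6) \<Rightarrow>
   real \<times> real \<Rightarrow> real \<times> real \<Rightarrow> ((real^6) \<Rightarrow>\<^sub>L (real^6))" where
  "tau_mid B sp sm p X =
     tau_form B sp p X + (1/2) *\<^sub>R ext_deriv (\<lambda>q. wedge B (sp q) (sm q)) p X"

text \<open>\<open>T : U \<rightarrow> O(4,2)\<close> solves \<open>dT = T \<mu> \<omega>\<close>.\<close>

definition integrates ::
  "(real^6 \<Rightarrow> real^6 \<Rightarrow> real) \<Rightarrow> (real \<times> real) set \<Rightarrow> real \<Rightarrow>
   (real \<times> real \<Rightarrow> real \<times> real \<Rightarrow> ((real^6) \<Rightarrow>\<^sub>L (real^6))) \<Rightarrow>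
   (real \<times> real \<Rightarrow> ((real^6) \<Rightarrow>\<^sub>L (real^6))) \<Rightarrow> bool" where
  "integrates B U \<mu> \<omega> T \<longleftrightarrow>
     (\<forall>p\<in>U. T p \<in> orth_group B \<and>
        (T has_derivative (\<lambda>X. T p o\<^sub>L (\<mu> *\<^sub>R \<omega> p X))) (at p))"

definition calapso_transformation ::
  "(real^6 \<Rightarrow> real^6 \<Rightarrow> real) \<Rightarrow> (real \<times> real) set \<Rightarrow> (real \<times> real \<Rightarrow> real^6) \<Rightarrow>
   (real \<Rightarrow> real \<times> real \<Rightarrow> ((real^6) \<Rightarrow>\<^sub>L (real^6))) \<Rightarrow> bool" where
  "calapso_transformation B U s T \<longleftrightarrow> (\<forall>\<mu>. integrates B U \<mu> (tau_form B s) (T \<mu>))"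

definition lie_deformation_transformation ::
  "(real^6 \<Rightarrow> real^6 \<Rightarrow> real) \<Rightarrow> (real \<times> real) set \<Rightarrow>
   (real \<times> real \<Rightarrow> real^6) \<Rightarrow> (real \<times> real \<Rightarrow> real^6) \<Rightarrow>
   (real \<Rightarrow> real \<times> real \<Rightarrow> ((real^6) \<Rightarrow>\<^sub>L (real^6))) \<Rightarrow> bool" where
  "lie_deformation_transformation B U sp sm T \<longleftrightarrow>
     (\<forall>\<mu>. integrates B U \<mu> (tau_mid B sp sm) (T \<mu>))"

end

(* Write N for the wedge of s+ and s-. Since f is null and (ds, s') = 0, N annihilates f, and all of
   N^2, tau+ N, N tau+ and N dN vanish. Hence if T+ integrates mu tau+, then T+ (1 + c N) integrates
   mu tau+ + c dN and agrees with T+ on f. The choice c = mu/2 gives T. Alignment gives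
   tau- = tau+ + dN, so c = mu gives T-.

   Alignment enters through s2 ^ s1_u = s1 ^ s2_v = 0. Write s1_u = a s1 + b s2. The Moutard equations
   put s1_uv into f, so differentiating in v modulo f leaves a s1_v, which must lie in f; as f is an
   immersion s1_v does not, whence a = 0.

   For the existence of T+, the Moutard equation makes tau+ closed, and its values commute at each
   point. Therefore each form T_n tau+ in the recursion dT_(n+1) = T_n tau+, T_0 = 1, is closed. On a
   convex domain the T_n thus exist, and their sum converges like an exponential series. A simply
   connected planar domain is conformally a disc or the plane, and pulling back by a holomorphic
   map preserves closedness. *)

theory Submission
  imports Defs "HOL-Complex_Analysis.Riemann_Mapping"
begin

section \<open>Integration of closed commuting operator-valued forms\<close>

text \<open>Values of tau+ at different points need not commute, so T+ is in general not the
  exponential of a primitive of tau+. Commutation at each point gives only tau+ ^ tau+ = 0, but this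
  is just what the recursion needs: d(T_n tau+) = T_(n-1) tau+ ^ tau+ + T_n d tau+, and both terms
  vanish. Every step is then an instance of the Poincare lemma. Its radial primitives ask for a
  domain that is star-shaped about the base point; one global chart onto a convex domain replaces
  the gluing of local solutions along paths.

  Only the system of tau+ is ever integrated. That its solution lies in O(4,2) is a separate
  argument, by the conserved quantity T T*, with T* the adjoint for \<open>B\<close>.

  In the alignment argument \<open>f\<close> is merely a subspace-valued map, so differentiating
  modulo f needs a justification: at a point, the derivative of a section modulo f depends only on
  the value of the section there. This rests on a determinant that avoids differentiable coefficient
  functions.\<close>

text \<open>Continuity in operator norm follows from continuity of the components, the arguments
  being finite-dimensional. It is needed where base point and direction vary together, as under the
  integral sign or in a pullback.\<close>

lemma continuous_derivative_blinfun:
  fixes \<omega> :: "'e::euclidean_space \<Rightarrow> 'f::euclidean_space \<Rightarrow>\<^sub>L 'b::real_normed_vector"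
  assumes der: "\<And>x. x \<in> D \<Longrightarrow> (\<omega> has_derivative \<omega>' x) (at x)"
    and cont: "\<And>X Y. continuous_on D (\<lambda>x. \<omega>' x Y X)"
  obtains \<Omega> where "\<And>x. x \<in> D \<Longrightarrow> blinfun_apply (\<Omega> x) = \<omega>' x" "continuous_on D \<Omega>"
proof
  show \<Omega>: "blinfun_apply (Blinfun (\<omega>' x)) = \<omega>' x" if "x \<in> D" for x
    by (rule bounded_linear_Blinfun_apply) (rule has_derivative_bounded_linear[OF der[OF that]])
  show "continuous_on D (\<lambda>x. Blinfun (\<omega>' x))"
  proof (intro continuous_on_blinfun_componentwise)
    fix X Y
    show "continuous_on D (\<lambda>x. Blinfun (\<omega>' x) Y X)"
      by (rule continuous_on_eq[OF cont[of Y X]]) (simp add: \<Omega>)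
  qed
qed

text \<open>The Poincare lemma with radial primitive. Differentiating under the integral gives t
  \<omega>'(tx)(X) x + \<omega>(tx) X; the symmetry \<open>sym\<close>, which is closedness,
  exchanges X and x in the first term, and the result is the t-derivative of t \<omega>(tx) X.
  Integration over [0,1] leaves \<omega>(x) X.\<close>

lemma closed_form_primitive:
  fixes \<omega> :: "'e::euclidean_space \<Rightarrow> 'e \<Rightarrow>\<^sub>L 'b::banach"
  assumes D: "open D" "convex D" "0 \<in> D"
    and der: "\<And>x. x \<in> D \<Longrightarrow> (\<omega> has_derivative \<omega>' x) (at x)"
    and cont: "\<And>X Y. continuous_on D (\<lambda>x. \<omega>' x Y X)"
    and sym: "\<And>x X Y. x \<in> D \<Longrightarrow> \<omega>' x Y X = \<omega>' x X Y"
    and x0: "x0 \<in> D"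
  shows "((\<lambda>x. integral {0..1} (\<lambda>t. \<omega> (t *\<^sub>R x) x)) has_derivative \<omega> x0) (at x0)"
proof -
  obtain \<Omega> where \<Omega>: "\<And>x. x \<in> D \<Longrightarrow> blinfun_apply (\<Omega> x) = \<omega>' x"
    and contD: "continuous_on D \<Omega>"
    using continuous_derivative_blinfun[OF der cont] by blast
  have cont\<omega>: "continuous_on D \<omega>"
    using der by (meson continuous_at_imp_continuous_on has_derivative_continuous)
  have inD: "t *\<^sub>R x \<in> D" if "x \<in> D" "t \<in> {0..1}" for x t
    using convexD[OF D(2) that(1) D(3), of t "1 - t"] that by simp
  define fx where "fx x t = t *\<^sub>R \<Omega> (t *\<^sub>R x) x + \<omega> (t *\<^sub>R x)" for x t
  have fx: "((\<lambda>x. \<omega> (t *\<^sub>R x) x) has_derivative fx x t) (at x within D)"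
    if "x \<in> D" "t \<in> cbox 0 1" for x t
  proof -
    have t: "t *\<^sub>R x \<in> D" using inD that by simp
    have "((\<lambda>x. \<omega> (t *\<^sub>R x)) has_derivative (\<lambda>X. \<omega>' (t *\<^sub>R x) (t *\<^sub>R X))) (at x within D)"
      by (rule has_derivative_compose[where f = "\<lambda>x. t *\<^sub>R x", OF _ der[OF t]])
        (auto intro!: derivative_eq_intros)
    then have "((\<lambda>x. \<omega> (t *\<^sub>R x) x) has_derivative
        (\<lambda>X. \<omega> (t *\<^sub>R x) X + \<omega>' (t *\<^sub>R x) (t *\<^sub>R X) x)) (at x within D)"
      by (auto intro!: derivative_eq_intros)
    \<comment> \<open>Closedness enters here: it moves the direction X to the last slot, so that the
      derivative becomes the bounded operator \<open>fx x t\<close> applied to X.\<close>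
    moreover have "\<omega>' (t *\<^sub>R x) (t *\<^sub>R X) x = t *\<^sub>R \<Omega> (t *\<^sub>R x) x X" for X
      by (simp add: \<Omega>[OF t, symmetric] blinfun.scaleR_right blinfun.scaleR_left)
        (simp add: \<Omega>[OF t] sym[OF t, of X x])
    ultimately show ?thesis
      by (elim has_derivative_eq_rhs) (auto simp: fx_def blinfun.add_left blinfun.scaleR_left)
  qed
  have cfx: "continuous_on (D \<times> cbox 0 1) (\<lambda>(x, t). fx x t)"
    unfolding fx_def split_beta
    by (intro continuous_intros continuous_on_compose2[OF contD] continuous_on_compose2[OF cont\<omega>])
      (auto intro: inD)
  have int: "(\<lambda>t. \<omega> (t *\<^sub>R x) x) integrable_on cbox 0 1" if "x \<in> D" for x
    by (intro integrable_continuous continuous_intros continuous_on_compose2[OF cont\<omega>])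
      (use that in \<open>auto intro: inD\<close>)
  have "((\<lambda>x. integral (cbox 0 1) (\<lambda>t. \<omega> (t *\<^sub>R x) x)) has_derivative
      integral (cbox 0 1) (fx x0)) (at x0 within D)"
    by (rule leibniz_rule[OF fx int cfx x0 D(2)])
  moreover have "(fx x0 has_integral (1 *\<^sub>R \<omega> (1 *\<^sub>R x0) - 0 *\<^sub>R \<omega> (0 *\<^sub>R x0))) {0..1}"
  proof (rule fundamental_theorem_of_calculus)
    fix t :: real assume t: "t \<in> {0..1}"
    have "((\<lambda>t. \<omega> (t *\<^sub>R x0)) has_derivative (\<lambda>h. \<omega>' (t *\<^sub>R x0) (h *\<^sub>R x0))) (at t within {0..1})"
      by (rule has_derivative_compose[where f = "\<lambda>t. t *\<^sub>R x0", OF _ der[OF inD[OF x0 t]]])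
        (auto intro!: derivative_eq_intros)
    then have "((\<lambda>t. t *\<^sub>R \<omega> (t *\<^sub>R x0)) has_derivative
       (\<lambda>h. t *\<^sub>R \<omega>' (t *\<^sub>R x0) (h *\<^sub>R x0) + h *\<^sub>R \<omega> (t *\<^sub>R x0))) (at t within {0..1})"
      by (rule has_derivative_scaleR[OF has_derivative_ident])
    then show "((\<lambda>t. t *\<^sub>R \<omega> (t *\<^sub>R x0)) has_vector_derivative fx x0 t) (at t within {0..1})"
      by (simp add: has_vector_derivative_def fx_def \<Omega>[OF inD[OF x0 t], symmetric]
          blinfun.scaleR_right scaleR_right_distrib mult.commute)
  qed simp
  ultimately show ?thesis
    by (simp add: at_within_open[OF x0 D(1)] integral_unique)
qed

section \<open>Picard iteration for dT = T W on convex domains\<close>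

text \<open>Left multiplication as an operator on operators. With it the form X \<mapsto> T(x)
  W(x)(X) becomes \<open>comp_left (T x) o\<^sub>L W x\<close>, of the type that
  \<open>closed_form_primitive\<close> integrates.\<close>

lift_definition comp_left :: "('b::real_normed_vector \<Rightarrow>\<^sub>L 'c::real_normed_vector) \<Rightarrow>
    ('a::real_normed_vector \<Rightarrow>\<^sub>L 'b) \<Rightarrow>\<^sub>L ('a \<Rightarrow>\<^sub>L 'c)" is "(o\<^sub>L)"
  by (rule bounded_bilinear.bounded_linear_right[OF bounded_bilinear_blinfun_compose])

lemma comp_left_apply [simp]: "blinfun_apply (comp_left S) V = S o\<^sub>L V"
  by transfer simp

lemma bounded_linear_comp_left [bounded_linear]:
  "bounded_linear (comp_left :: ('b::real_normed_vector \<Rightarrow>\<^sub>L 'c::real_normed_vector) \<Rightarrow>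
    ('a::real_normed_vector \<Rightarrow>\<^sub>L 'b) \<Rightarrow>\<^sub>L ('a \<Rightarrow>\<^sub>L 'c))"
proof (rule bounded_linear_intro[where K = 1])
  fix S :: "'b \<Rightarrow>\<^sub>L 'c"
  show "norm (comp_left S :: ('a \<Rightarrow>\<^sub>L 'b) \<Rightarrow>\<^sub>L ('a \<Rightarrow>\<^sub>L 'c)) \<le> norm S * 1"
    by (rule norm_blinfun_bound) (simp_all add: norm_blinfun_compose)
qed (auto intro!: blinfun_eqI simp: blinfun.bilinear_simps)

text \<open>The integral is the radial primitive based at 0 of the form T_n W. Hence all iterates
  but the zeroth vanish at 0, which fixes the initial value of their sum.\<close>

primrec picard :: "('e::euclidean_space \<Rightarrow> 'e \<Rightarrow>\<^sub>L ('a::banach \<Rightarrow>\<^sub>L 'a)) \<Rightarrow> nat \<Rightarrow> 'e \<Rightarrow> 'a \<Rightarrow>\<^sub>L 'a" where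
  "picard W 0 = (\<lambda>x. id_blinfun)"
| "picard W (Suc n) = (\<lambda>x. integral {0..1} (\<lambda>t. picard W n (t *\<^sub>R x) o\<^sub>L W (t *\<^sub>R x) x))"

lemma blinfun_compose_assoc: "(A o\<^sub>L B) o\<^sub>L C = A o\<^sub>L (B o\<^sub>L C)"
  by (rule blinfun_eqI) simp

text \<open>The derivative of T_n W in direction Y, evaluated at X, is T_n W'(Y)(X) + T_(n-1) W(Y)
  W(X). The first term is symmetric in X, Y because W is closed, the second because the values of W
  at a point commute.\<close>

lemma picard_derivative:
  fixes W :: "'e::euclidean_space \<Rightarrow> 'e \<Rightarrow>\<^sub>L ('a::banach \<Rightarrow>\<^sub>L 'a)"
  assumes D: "open D" "convex D" "0 \<in> D"
    and der: "\<And>x. x \<in> D \<Longrightarrow> (W has_derivative W' x) (at x)"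
    and cont: "\<And>X Y. continuous_on D (\<lambda>x. W' x Y X)"
    and sym: "\<And>x X Y. x \<in> D \<Longrightarrow> W' x Y X = W' x X Y"
    and comm: "\<And>x X Y. x \<in> D \<Longrightarrow> W x X o\<^sub>L W x Y = W x Y o\<^sub>L W x X"
  shows "continuous_on D (picard W n) \<and>
    (\<forall>x\<in>D. (picard W (Suc n) has_derivative (\<lambda>X. picard W n x o\<^sub>L W x X)) (at x))"
proof (induction n)
  have contW: "continuous_on D W"
    using der by (meson continuous_at_imp_continuous_on has_derivative_continuous)
  \<comment> \<open>A derivative \<open>T'\<close> of T_n is kept abstract, subject to the symmetry
    \<open>T's\<close>. This serves both cases of the induction: it is 0 for the constant T_0, and
    T_n W for T_(n+1).\<close>
  have step: "continuous_on D (picard W n) \<and>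
      (\<forall>x\<in>D. (picard W (Suc n) has_derivative (\<lambda>X. picard W n x o\<^sub>L W x X)) (at x))"
    if T': "\<And>x. x \<in> D \<Longrightarrow> (picard W n has_derivative T' x) (at x)"
      and T'c: "\<And>Y. continuous_on D (\<lambda>x. T' x Y)"
      and T's: "\<And>x X Y. x \<in> D \<Longrightarrow> T' x Y o\<^sub>L W x X = T' x X o\<^sub>L W x Y" for n T'
  proof (intro conjI ballI)
    show contT: "continuous_on D (picard W n)"
      using T' by (meson continuous_at_imp_continuous_on has_derivative_continuous)
    fix x assume x: "x \<in> D"
    have "((\<lambda>x. integral {0..1} (\<lambda>t. (comp_left (picard W n (t *\<^sub>R x)) o\<^sub>L W (t *\<^sub>R x)) x))
        has_derivative (comp_left (picard W n x) o\<^sub>L W x)) (at x)"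
    proof (rule closed_form_primitive[OF D _ _ _ x])
      show "((\<lambda>x. comp_left (picard W n x) o\<^sub>L W x) has_derivative
          (\<lambda>Y. (comp_left (picard W n x) o\<^sub>L W' x Y) + (comp_left (T' x Y) o\<^sub>L W x))) (at x)"
        if "x \<in> D" for x
        using T'[OF that] der[OF that] by (auto intro!: derivative_eq_intros)
      show "continuous_on D (\<lambda>x. ((comp_left (picard W n x) o\<^sub>L W' x Y) + (comp_left (T' x Y) o\<^sub>L W x)) X)"
        for X Y
        unfolding blinfun.add_left blinfun_apply_blinfun_compose comp_left_apply
        by (intro continuous_intros contT contW cont T'c)
      show "((comp_left (picard W n x) o\<^sub>L W' x Y) + (comp_left (T' x Y) o\<^sub>L W x)) X =
          ((comp_left (picard W n x) o\<^sub>L W' x X) + (comp_left (T' x X) o\<^sub>L W x)) Y"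
        if "x \<in> D" for x X Y
        by (simp add: blinfun.add_left T's[OF that, of Y X] sym[OF that, of Y X])
    qed
    then show "(picard W (Suc n) has_derivative (\<lambda>X. picard W n x o\<^sub>L W x X)) (at x)"
      by simp (erule has_derivative_eq_rhs, simp add: fun_eq_iff)
  qed
  {
    case 0
    show ?case
      by (rule step[where T' = "\<lambda>_ _. 0"]) auto
  next
    case (Suc n)
    show ?case
    proof (rule step[where T' = "\<lambda>x X. picard W n x o\<^sub>L W x X"])
      show "picard W n x o\<^sub>L W x Y o\<^sub>L W x X = picard W n x o\<^sub>L W x X o\<^sub>L W x Y" if "x \<in> D" for x X Y
        using comm[OF that, of X Y] by (simp add: blinfun_compose_assoc)
      show "continuous_on D (\<lambda>x. picard W n x o\<^sub>L W x Y)" for Y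
        using Suc.IH contW by (intro continuous_intros) auto
    qed (use Suc.IH in blast)
  }
qed

text \<open>Keeping \<open>norm x\<close> in the bound, instead of its supremum, is what produces
  the factorial: on the ray the bound for T_n carries t^n, and the integral of t^n over [0,1] is
  1/(n+1).\<close>

lemma picard_bound:
  fixes W :: "'e::euclidean_space \<Rightarrow> 'e \<Rightarrow>\<^sub>L ('a::banach \<Rightarrow>\<^sub>L 'a)"
  assumes K: "\<And>x t. x \<in> K \<Longrightarrow> t \<in> {0..1} \<Longrightarrow> t *\<^sub>R x \<in> K"
    and W: "continuous_on K W" "\<And>x. x \<in> K \<Longrightarrow> norm (W x) \<le> M"
    and P: "\<And>n. continuous_on K (picard W n)"
    and x: "x \<in> K"
  shows "norm (picard W n x) \<le> (M * norm x) ^ n / fact n"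
  using x
proof (induction n arbitrary: x)
  case 0
  show ?case by (simp add: norm_blinfun_id_le)
next
  case (Suc n)
  have M: "M \<ge> 0"
    using W(2)[OF Suc.prems] norm_ge_zero[of "W x"] by linarith
  have "((\<lambda>t. t ^ n) has_integral 1 ^ Suc n / real (Suc n) - 0 ^ Suc n / real (Suc n)) {0..1::real}"
    by (rule fundamental_theorem_of_calculus)
      (auto intro!: derivative_eq_intros simp: has_real_derivative_iff_has_vector_derivative[symmetric]
        simp del: power_Suc of_nat_Suc)
  then have "((\<lambda>t. (M * norm x) ^ Suc n / fact n * t ^ n) has_integral
      (M * norm x) ^ Suc n / fact n * (1 / real (Suc n))) {0..1}"
    by (intro has_integral_mult_right) simp
  then have int: "((\<lambda>t. (M * norm x) ^ Suc n / fact n * t ^ n) has_integral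
      (M * norm x) ^ Suc n / fact (Suc n)) {0..1}"
    by (simp only: fact_Suc of_nat_mult times_divide_times_eq mult_1_right mult_1_left mult.commute)
  have "norm (picard W (Suc n) x) \<le> integral {0..1} (\<lambda>t. (M * norm x) ^ Suc n / fact n * t ^ n)"
    unfolding picard.simps
  proof (rule integral_norm_bound_integral)
    show "(\<lambda>t. picard W n (t *\<^sub>R x) o\<^sub>L W (t *\<^sub>R x) x) integrable_on {0..1}"
      by (intro integrable_continuous_interval continuous_intros
          continuous_on_compose2[OF W(1)] continuous_on_compose2[OF P]) (use Suc.prems K in auto)
    fix t :: real assume t: "t \<in> {0..1}"
    have "norm (picard W n (t *\<^sub>R x) o\<^sub>L W (t *\<^sub>R x) x)
        \<le> norm (picard W n (t *\<^sub>R x)) * norm (W (t *\<^sub>R x) x)"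
      by (rule norm_blinfun_compose)
    also have "\<dots> \<le> (M * norm (t *\<^sub>R x)) ^ n / fact n * (M * norm x)"
    proof (rule mult_mono)
      show "norm (W (t *\<^sub>R x) x) \<le> M * norm x"
        by (rule order_trans[OF norm_blinfun]) (intro mult_right_mono W(2) K Suc.prems t norm_ge_zero)
    qed (use Suc.IH[OF K[OF Suc.prems t]] M in auto)
    also have "\<dots> = (M * norm x) ^ Suc n / fact n * t ^ n"
      using t by (simp add: power_mult_distrib)
    finally show "norm (picard W n (t *\<^sub>R x) o\<^sub>L W (t *\<^sub>R x) x)
        \<le> (M * norm x) ^ Suc n / fact n * t ^ n" .
  qed (use int in blast)
  also have "\<dots> = (M * norm x) ^ Suc n / fact (Suc n)"
    using int by (rule integral_unique)
  finally show ?case .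
qed

lemma total_differential_convex:
  fixes W :: "'e::euclidean_space \<Rightarrow> 'e \<Rightarrow>\<^sub>L ('a::banach \<Rightarrow>\<^sub>L 'a)"
  assumes D: "open D" "convex D" "0 \<in> D"
    and der: "\<And>x. x \<in> D \<Longrightarrow> (W has_derivative W' x) (at x)"
    and cont: "\<And>X Y. continuous_on D (\<lambda>x. W' x Y X)"
    and sym: "\<And>x X Y. x \<in> D \<Longrightarrow> W' x Y X = W' x X Y"
    and comm: "\<And>x X Y. x \<in> D \<Longrightarrow> W x X o\<^sub>L W x Y = W x Y o\<^sub>L W x X"
  obtains T where "T 0 = id_blinfun"
    "\<And>x. x \<in> D \<Longrightarrow> (T has_derivative (\<lambda>X. T x o\<^sub>L W x X)) (at x)"
proof -
  note picard = picard_derivative[OF D der cont sym comm]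
  define T where "T x = (\<Sum>n. picard W n x)" for x
  have contW: "continuous_on D W"
    using der by (meson continuous_at_imp_continuous_on has_derivative_continuous)
  have "picard W n 0 = (if n = 0 then id_blinfun else 0)" for n
    by (cases n) auto
  then have T0: "T 0 = id_blinfun"
    unfolding T_def by (subst suminf_finite[of "{0}"]) auto
  have "(T has_derivative (\<lambda>X. T x0 o\<^sub>L W x0 X)) (at x0)" if x0: "x0 \<in> D" for x0
  proof -
    obtain \<epsilon> where \<epsilon>: "\<epsilon> > 0" "cball x0 \<epsilon> \<subseteq> D"
      using D(1) x0 open_contains_cball by blast
    \<comment> \<open>The union of the segments from 0 to the points of a closed ball about
      \<open>x0\<close>: compact, so that W is bounded on it, and closed under shrinking towards 0,
      as the bound on the iterates demands.\<close>
    define K where "K = (\<lambda>(t, x). t *\<^sub>R x) ` ({0..1::real} \<times> cball x0 \<epsilon>)"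
    have "compact K"
      unfolding K_def split_beta by (intro compact_continuous_image continuous_intros compact_Times) auto
    have "t *\<^sub>R x \<in> D" if "x \<in> D" "t \<in> {0..1}" for x t
      using convexD[OF D(2) that(1) D(3), of t "1 - t"] that by simp
    then have KD: "K \<subseteq> D"
      using \<epsilon>(2) by (auto simp: K_def)
    have Kt: "t *\<^sub>R x \<in> K" if "x \<in> K" "t \<in> {0..1}" for x t
    proof -
      obtain s y where "x = s *\<^sub>R y" "s \<in> {0..1}" "y \<in> cball x0 \<epsilon>"
        using \<open>x \<in> K\<close> unfolding K_def by auto
      then show ?thesis
        unfolding K_def using that by (intro image_eqI[of _ _ "(t * s, y)"]) (auto simp: mult_le_one)
    qed
    have ballK: "ball x0 \<epsilon> \<subseteq> K"
    proof
      fix x assume "x \<in> ball x0 \<epsilon>"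
      then show "x \<in> K"
        unfolding K_def by (intro image_eqI[of _ _ "(1, x)"]) auto
    qed
    have "bounded (W ` K)"
      using \<open>compact K\<close> contW KD by (meson compact_continuous_image compact_imp_bounded continuous_on_subset)
    then obtain M where M: "M > 0" "\<And>x. x \<in> K \<Longrightarrow> norm (W x) \<le> M"
      unfolding bounded_pos by auto
    obtain R where R: "R > 0" "\<And>x. x \<in> K \<Longrightarrow> norm x \<le> R"
      using compact_imp_bounded[OF \<open>compact K\<close>] unfolding bounded_pos by auto
    have bound: "norm (picard W n x) \<le> (M * R) ^ n / fact n" if "x \<in> K" for x n
    proof -
      have "norm (picard W n x) \<le> (M * norm x) ^ n / fact n"
        using picard contW KD
        by (intro picard_bound[OF Kt _ M(2) _ that]) (auto intro: continuous_on_subset)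
      also have "\<dots> \<le> (M * R) ^ n / fact n"
        using M(1) R(2)[OF that] by (intro divide_right_mono power_mono mult_left_mono) auto
      finally show ?thesis .
    qed
    have summ: "summable (\<lambda>n. (M * R) ^ n / fact n)"
      using summable_exp_generic[of "M * R"] by (simp add: field_simps)
    have unif: "uniform_limit K (\<lambda>n x. \<Sum>i<n. picard W i x) T sequentially"
      unfolding T_def by (rule Weierstrass_m_test[OF bound summ])
    have sums: "(\<lambda>n. picard W n x) sums T x" if "x \<in> K" for x
      unfolding T_def
      by (rule summable_sums, rule summable_comparison_test'[OF summ]) (rule bound[OF that])
    \<comment> \<open>The derivative of T_(n+1) is T_n W. Differentiating term by term therefore
      starts from the shifted series, with sum T - 1, while the derivatives sum to T W; the identity
      is added back afterwards.\<close>
    have sums': "(\<lambda>n. picard W (Suc n) x) sums (T x - id_blinfun)" if "x \<in> K" for x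
      using sums[OF that] by (subst sums_Suc_iff) simp
    have "\<exists>g. \<forall>x\<in>ball x0 \<epsilon>. (\<lambda>n. picard W (Suc n) x) sums (g x) \<and>
        (g has_derivative (\<lambda>X. T x o\<^sub>L W x X)) (at x within ball x0 \<epsilon>)"
    proof (rule has_derivative_series[OF convex_ball])
      show "(picard W (Suc n) has_derivative (\<lambda>X. picard W n x o\<^sub>L W x X)) (at x within ball x0 \<epsilon>)"
        if "x \<in> ball x0 \<epsilon>" for n x
        using picard that KD ballK by (meson has_derivative_at_withinI subsetD)
      show "x0 \<in> ball x0 \<epsilon>" using \<epsilon> by simp
      then show "(\<lambda>n. picard W (Suc n) x0) sums (T x0 - id_blinfun)"
        using sums' ballK by blast
      fix e :: real assume e: "e > 0"
      have "\<forall>\<^sub>F n in sequentially. \<forall>x\<in>K. norm ((\<Sum>i<n. picard W i x) - T x) < e / M"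
        using uniform_limitD[OF unif, of "e / M"] e M(1) by (simp add: dist_norm)
      then show "\<forall>\<^sub>F n in sequentially. \<forall>x\<in>ball x0 \<epsilon>. \<forall>h.
          norm ((\<Sum>i<n. picard W i x o\<^sub>L W x h) - (T x o\<^sub>L W x h)) \<le> e * norm h"
      proof eventually_elim
        case (elim n)
        show ?case
        proof (intro ballI allI)
          fix x h assume "x \<in> ball x0 \<epsilon>"
          then have x: "x \<in> K" using ballK by blast
          have "norm ((\<Sum>i<n. picard W i x o\<^sub>L W x h) - (T x o\<^sub>L W x h))
              = norm (((\<Sum>i<n. picard W i x) - T x) o\<^sub>L W x h)"
            by (simp add: bounded_bilinear.sum_left[OF bounded_bilinear_blinfun_compose]
                bounded_bilinear.diff_left[OF bounded_bilinear_blinfun_compose])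
          also have "\<dots> \<le> norm ((\<Sum>i<n. picard W i x) - T x) * norm (W x h)"
            by (rule norm_blinfun_compose)
          also have "\<dots> \<le> (e / M) * (M * norm h)"
          proof (rule mult_mono)
            show "norm (W x h) \<le> M * norm h"
              by (rule order_trans[OF norm_blinfun]) (intro mult_right_mono M x norm_ge_zero)
          qed (use elim x e M in \<open>auto simp: less_imp_le\<close>)
          also have "\<dots> = e * norm h" using M by simp
          finally show "norm ((\<Sum>i<n. picard W i x o\<^sub>L W x h) - (T x o\<^sub>L W x h)) \<le> e * norm h" .
        qed
      qed
    qed
    then obtain g where g: "\<And>x. x \<in> ball x0 \<epsilon> \<Longrightarrow> (\<lambda>n. picard W (Suc n) x) sums (g x)"
      "\<And>x. x \<in> ball x0 \<epsilon> \<Longrightarrow> (g has_derivative (\<lambda>X. T x o\<^sub>L W x X)) (at x within ball x0 \<epsilon>)"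
      by blast
    have "(g has_derivative (\<lambda>X. T x0 o\<^sub>L W x0 X)) (at x0)"
      using g(2)[of x0] \<epsilon> by (simp add: at_within_open[OF _ open_ball])
    then have deriv: "((\<lambda>x. id_blinfun + g x) has_derivative (\<lambda>X. T x0 o\<^sub>L W x0 X)) (at x0)"
      by (auto intro!: derivative_eq_intros)
    have eq: "id_blinfun + g x = T x" if "x \<in> ball x0 \<epsilon>" for x
    proof -
      have "x \<in> K" using ballK that by blast
      then have "g x = T x - id_blinfun"
        by (rule sums_unique2[OF g(1)[OF that] sums'])
      then show ?thesis by simp
    qed
    show ?thesis
      by (rule has_derivative_transform_within_open[OF deriv open_ball _ eq]) (use \<epsilon> in simp_all)
  qed
  with T0 show thesis
    by (rule that)
qed

section \<open>From convex domains to simply connected planar domains\<close>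

text \<open>The form is pulled back along the biholomorphic map G from a convex domain, integrated
  there, and the solution is carried back by the inverse H. The pullback is again closed: the extra
  term W(G'') is symmetric since G'' is multiplication by a complex number in both arguments. Its
  values at a point are values of W at one point, so they still commute.\<close>

lemma total_differential_simply_connected:
  fixes W :: "real \<times> real \<Rightarrow> (real \<times> real) \<Rightarrow>\<^sub>L ('a::banach \<Rightarrow>\<^sub>L 'a)"
  assumes U: "open U" "simply_connected U" "U \<noteq> {}"
    and der: "\<And>x. x \<in> U \<Longrightarrow> (W has_derivative W' x) (at x)"
    and cont: "\<And>X Y. continuous_on U (\<lambda>x. W' x Y X)"
    and sym: "\<And>x X Y. x \<in> U \<Longrightarrow> W' x Y X = W' x X Y"
    and comm: "\<And>x X Y. x \<in> U \<Longrightarrow> W x X o\<^sub>L W x Y = W x Y o\<^sub>L W x X"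
  obtains T p0 where "p0 \<in> U" "T p0 = id_blinfun"
    "\<And>p. p \<in> U \<Longrightarrow> (T has_derivative (\<lambda>X. T p o\<^sub>L W p X)) (at p)"
proof -
  define c where "c p = Complex (fst p) (snd p)" for p
  define r where "r z = (Re z, Im z)" for z
  have rc [simp]: "r (c p) = p" "c (r z) = z" for p z
    by (simp_all add: r_def c_def)
  have c: "bounded_linear c"
    by (rule linear_conv_bounded_linear[THEN iffD1], rule linearI) (simp_all add: c_def complex_eq_iff)
  have r: "bounded_linear r"
    by (rule linear_conv_bounded_linear[THEN iffD1], rule linearI) (simp_all add: r_def)
  have surj: "surj c"
    by (metis rc(2) surjI)
  have "open (c ` U)"
    using open_surjective_linear_image[OF U(1) bounded_linear.linear[OF c] surj] .
  moreover have "simply_connected (c ` U)"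
  proof -
    have "U homeomorphic c ` U"
      unfolding homeomorphic_def homeomorphism_def
      by (rule exI[of _ c], rule exI[of _ r])
        (use c r in \<open>auto simp: image_image intro: linear_continuous_on\<close>)
    then show ?thesis
      using U(2) homeomorphic_simply_connected_eq by blast
  qed
  moreover have "c ` U \<noteq> {}" using U(3) by simp
  ultimately obtain D h g where D: "open D" "convex D" "(0::complex) \<in> D"
    and h: "h holomorphic_on c ` U" and g: "g holomorphic_on D"
    and hg: "\<And>z. z \<in> c ` U \<Longrightarrow> h z \<in> D \<and> g (h z) = z"
    and gh: "\<And>z. z \<in> D \<Longrightarrow> g z \<in> c ` U \<and> h (g z) = z"
  \<comment> \<open>The plane has no biholomorphic map onto the disc, by Liouville's theorem, but it
    is convex already.\<close>
  proof (cases "c ` U = UNIV")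
    case True
    then show thesis
      by (intro that[of UNIV id id]) auto
  next
    case False
    then obtain h g where "h holomorphic_on c ` U" "g holomorphic_on ball 0 1"
      "\<forall>z\<in>c ` U. h z \<in> ball 0 1 \<and> g (h z) = z" "\<forall>z\<in>ball 0 1. g z \<in> c ` U \<and> h (g z) = z"
      using simply_connected_eq_biholomorphic_to_disc[OF \<open>open (c ` U)\<close>]
        \<open>simply_connected (c ` U)\<close> \<open>c ` U \<noteq> {}\<close> by blast
    then show thesis
      by (intro that[of "ball 0 1" h g]) auto
  qed
  define G where "G z = r (g z)" for z
  define H where "H p = h (c p)" for p
  \<comment> \<open>\<open>G1\<close> is the real derivative of G, and \<open>G2 z Y\<close> the
    derivative of \<open>G1\<close> at z in direction Y.\<close>
  define G1 where "G1 z = Blinfun r o\<^sub>L blinfun_mult_right (deriv g z)" for z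
  define G2 where "G2 z Y = Blinfun r o\<^sub>L blinfun_mult_right (deriv (deriv g) z * Y)" for z Y
  have r_apply: "blinfun_apply (Blinfun r) = r"
    by (rule bounded_linear_Blinfun_apply[OF r])
  have GU: "G z \<in> U" "H (G z) = z" if "z \<in> D" for z
    using gh[OF that] by (auto simp: G_def H_def)
  have HD: "H p \<in> D" "G (H p) = p" if "p \<in> U" for p
    using hg[of "c p"] that by (auto simp: G_def H_def)
  have g': "(g has_derivative (*) (deriv g z)) (at z)"
    and g'': "(deriv g has_derivative (*) (deriv (deriv g) z)) (at z)" if "z \<in> D" for z
    using holomorphic_derivI[OF g D(1) that]
      holomorphic_derivI[OF holomorphic_deriv[OF g D(1)] D(1) that]
    by (simp_all add: has_field_derivative_def)
  have G': "(G has_derivative G1 z) (at z)" if "z \<in> D" for z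
    unfolding G_def G1_def
    by (rule has_derivative_eq_rhs[OF bounded_linear.has_derivative[OF r g'[OF that]]])
      (auto simp: r_apply blinfun_mult_right.rep_eq)
  have G'': "(G1 has_derivative G2 z) (at z)" if "z \<in> D" for z
  proof -
    have "((\<lambda>z. blinfun_mult_right (deriv g z)) has_derivative
        (\<lambda>Y. blinfun_mult_right (deriv (deriv g) z * Y))) (at z)"
      by (rule bounded_linear.has_derivative[OF bounded_linear_blinfun_mult_right g''[OF that]])
    from has_derivative_compose[OF this, of "\<lambda>V. Blinfun r o\<^sub>L V" "\<lambda>V. Blinfun r o\<^sub>L V"]
    show ?thesis
      unfolding G1_def G2_def
      by (simp add: bounded_linear_imp_has_derivative
          bounded_bilinear.bounded_linear_right[OF bounded_bilinear_blinfun_compose])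
  qed
  obtain \<Omega> where \<Omega>: "\<And>x. x \<in> U \<Longrightarrow> blinfun_apply (\<Omega> x) = W' x" "continuous_on U \<Omega>"
    using continuous_derivative_blinfun[OF der cont] by blast
  define V where "V z = W (G z) o\<^sub>L G1 z" for z
  define V' where "V' z Y = (W (G z) o\<^sub>L G2 z Y) + (W' (G z) (G1 z Y) o\<^sub>L G1 z)" for z Y
  have contG: "continuous_on D G" and contG1: "continuous_on D G1"
    using G' G'' by (meson continuous_at_imp_continuous_on has_derivative_continuous)+
  have contG2: "continuous_on D (\<lambda>z. G2 z Y)" for Y
    unfolding G2_def
    by (intro continuous_intros bounded_linear.continuous_on[OF bounded_linear_blinfun_mult_right]
        holomorphic_on_imp_continuous_on[OF holomorphic_deriv[OF holomorphic_deriv[OF g D(1)] D(1)]])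
  have contW: "continuous_on U W"
    using der by (meson continuous_at_imp_continuous_on has_derivative_continuous)
  obtain T where T0: "T 0 = id_blinfun"
    and T: "\<And>z. z \<in> D \<Longrightarrow> (T has_derivative (\<lambda>X. T z o\<^sub>L V z X)) (at z)"
  proof (rule total_differential_convex[OF D])
    fix z assume z: "z \<in> D"
    have "((\<lambda>z. W (G z)) has_derivative (\<lambda>Y. W' (G z) (G1 z Y))) (at z)"
      by (rule has_derivative_compose[OF G'[OF z] der[OF GU(1)[OF z]]])
    then show "(V has_derivative V' z) (at z)"
      unfolding V_def V'_def
      by (rule bounded_bilinear.FDERIV[OF bounded_bilinear_blinfun_compose _ G''[OF z]])
    show "V' z Y X = V' z X Y" for X Y
      by (simp add: V'_def blinfun.add_left sym[OF GU(1)[OF z]] G2_def r_apply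
          blinfun_mult_right.rep_eq mult.commute mult.left_commute)
    show "V z X o\<^sub>L V z Y = V z Y o\<^sub>L V z X" for X Y
      by (simp add: V_def comm[OF GU(1)[OF z], of "G1 z X"])
  next
    fix X Y
    have "continuous_on D (\<lambda>z. W (G z) (G2 z Y X) + \<Omega> (G z) (G1 z Y) (G1 z X))"
      using GU(1) by (intro continuous_intros contG1 contG2 contG
          continuous_on_compose2[OF contW contG] continuous_on_compose2[OF \<Omega>(2) contG]) auto
    then show "continuous_on D (\<lambda>z. V' z Y X)"
      by (rule continuous_on_eq) (simp add: V'_def blinfun.add_left \<Omega> GU)
  qed blast
  have "((\<lambda>p. T (H p)) has_derivative (\<lambda>X. T (H p) o\<^sub>L W p X)) (at p)" if p: "p \<in> U" for p
  proof -
    have "(h has_derivative (*) (deriv h (c p))) (at (c p))"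
      using holomorphic_derivI[OF h \<open>open (c ` U)\<close>, of "c p"] p
      by (simp add: has_field_derivative_def)
    from has_derivative_compose[OF bounded_linear_imp_has_derivative[OF c] this]
    have H': "(H has_derivative (\<lambda>X. deriv h (c p) * c X)) (at p)"
      unfolding H_def .
    have "((\<lambda>p. G (H p)) has_derivative (\<lambda>X. G1 (H p) (deriv h (c p) * c X))) (at p)"
      by (rule has_derivative_compose[OF H' G'[OF HD(1)[OF p]]])
    from has_derivative_transform_within_open[OF this U(1) p HD(2)]
    \<comment> \<open>The chain rule for G(H p) = p: the derivative of G inverts that of H, so
      pulling V back along H returns W.\<close>
    have "(\<lambda>X. G1 (H p) (deriv h (c p) * c X)) = (\<lambda>X. X)"
      using has_derivative_unique has_derivative_ident by blast
    then have G1: "G1 (H p) (deriv h (c p) * c X) = X" for X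
      by meson
    show ?thesis
      using has_derivative_compose[OF H' T[OF HD(1)[OF p]]]
      by (simp add: V_def HD(2)[OF p] G1)
  qed
  moreover have "T (H (G 0)) = id_blinfun"
    using GU(2)[OF D(3)] T0 by simp
  ultimately show thesis
    using that[of "G 0" "\<lambda>p. T (H p)"] GU(1)[OF D(3)] by blast
qed

section \<open>Partial derivatives\<close>

lemma ext_deriv_eqI: "(g has_derivative g') (at p) \<Longrightarrow> ext_deriv g p X = g' X"
  unfolding ext_deriv_def by (metis frechet_derivative_at)

lemma has_derivative_partials:
  assumes "g differentiable (at p)"
  shows "(g has_derivative (\<lambda>X. fst X *\<^sub>R partial_u g p + snd X *\<^sub>R partial_v g p)) (at p)"
proof -
  have g: "(g has_derivative frechet_derivative g (at p)) (at p)"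
    using assms frechet_derivative_works by blast
  then have lin: "linear (frechet_derivative g (at p))"
    by (rule has_derivative_linear)
  have "frechet_derivative g (at p) X = fst X *\<^sub>R partial_u g p + snd X *\<^sub>R partial_v g p" for X
  proof -
    have "X = fst X *\<^sub>R (1, 0) + snd X *\<^sub>R (0, 1)"
      by (simp add: prod_eq_iff)
    then show ?thesis
      unfolding partial_u_def partial_v_def ext_deriv_def
      by (metis linear_add[OF lin] linear_scale[OF lin])
  qed
  then show ?thesis
    by (intro has_derivative_eq_rhs[OF g] ext)
qed

lemma ext_deriv_partials:
  assumes "g differentiable (at p)"
  shows "ext_deriv g p X = fst X *\<^sub>R partial_u g p + snd X *\<^sub>R partial_v g p"
  by (rule ext_deriv_eqI[OF has_derivative_partials[OF assms]])

lemma smooth_onD: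
  assumes "smooth_on U g"
  shows smooth_on_differentiable: "p \<in> U \<Longrightarrow> g differentiable (at p)"
    and smooth_on_partial_u: "smooth_on U (partial_u g)"
    and smooth_on_partial_v: "smooth_on U (partial_v g)"
    and smooth_on_continuous: "continuous_on U g"
  using assms Ck_on.simps(1) Ck_on.simps(2) unfolding smooth_on_def by metis+

lemma smooth_on_has_derivative:
  assumes "smooth_on U g" "p \<in> U"
  shows "(g has_derivative (\<lambda>X. fst X *\<^sub>R partial_u g p + snd X *\<^sub>R partial_v g p)) (at p)"
  using assms by (intro has_derivative_partials smooth_on_differentiable)

lemma partials_cong:
  assumes "open U" "p \<in> U" "\<And>q. q \<in> U \<Longrightarrow> g q = h q" "g differentiable (at p)"
  shows "partial_u g p = partial_u h p" "partial_v g p = partial_v h p"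
proof -
  have "(h has_derivative (\<lambda>X. fst X *\<^sub>R partial_u g p + snd X *\<^sub>R partial_v g p)) (at p)"
    using has_derivative_transform_within_open[OF has_derivative_partials[OF assms(4)] assms(1-3)] .
  note ext_deriv_eqI[OF this]
  then show "partial_u g p = partial_u h p" "partial_v g p = partial_v h p"
    by (simp_all add: partial_u_def[of h] partial_v_def[of h])
qed

section \<open>Symmetry of second partial derivatives\<close>

text \<open>The second difference of \<open>f\<close> over a square of side t is t^2 times a value
  of \<open>fuv\<close> and also t^2 times a value of \<open>fvu\<close>, by two mean value theorems
  taken in either order. Continuity then excludes a gap at (a, b).\<close>

lemma mixed_partials_real:
  fixes f fu fv fuv fvu :: "real \<times> real \<Rightarrow> real"
  assumes U: "open U" "(a, b) \<in> U"
    and fu: "\<And>x y. (x, y) \<in> U \<Longrightarrow> ((\<lambda>x. f (x, y)) has_real_derivative fu (x, y)) (at x)"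
    and fv: "\<And>x y. (x, y) \<in> U \<Longrightarrow> ((\<lambda>y. f (x, y)) has_real_derivative fv (x, y)) (at y)"
    and fuv: "\<And>x y. (x, y) \<in> U \<Longrightarrow> ((\<lambda>y. fu (x, y)) has_real_derivative fuv (x, y)) (at y)"
    and fvu: "\<And>x y. (x, y) \<in> U \<Longrightarrow> ((\<lambda>x. fv (x, y)) has_real_derivative fvu (x, y)) (at x)"
    and cont: "continuous_on U fuv" "continuous_on U fvu"
  shows "fuv (a, b) = fvu (a, b)"
proof (rule ccontr)
  assume ne: "fuv (a, b) \<noteq> fvu (a, b)"
  \<comment> \<open>On S both mixed partials stay within half of their supposed gap, so no value of
    \<open>fuv\<close> on S equals a value of \<open>fvu\<close> on S.\<close>
  define S where "S = {q \<in> U. \<bar>fuv q - fuv (a, b)\<bar> < \<bar>fuv (a, b) - fvu (a, b)\<bar> / 2} \<inter>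
    {q \<in> U. \<bar>fvu q - fvu (a, b)\<bar> < \<bar>fuv (a, b) - fvu (a, b)\<bar> / 2}"
  have "open {q \<in> U. \<bar>h q - h (a, b)\<bar> < e}" if "continuous_on U h" for h :: "real \<times> real \<Rightarrow> real" and e
  proof -
    have "{q \<in> U. \<bar>h q - h (a, b)\<bar> < e} = U \<inter> h -` ball (h (a, b)) e"
      by (auto simp: dist_real_def)
    then show ?thesis
      using continuous_open_preimage[OF that U(1) open_ball] by simp
  qed
  then have "open S"
    unfolding S_def using cont by blast
  moreover have "(a, b) \<in> S"
    using ne U(2) by (simp add: S_def)
  ultimately obtain A C where AC: "open A" "open C" "a \<in> A" "b \<in> C" "A \<times> C \<subseteq> S"
    by (rule open_prod_elim) auto
  obtain t1 where t1: "t1 > 0" "cball a t1 \<subseteq> A"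
    using AC open_contains_cball by blast
  obtain t2 where t2: "t2 > 0" "cball b t2 \<subseteq> C"
    using AC open_contains_cball by blast
  define t where "t = min t1 t2"
  have t: "t > 0" using t1 t2 by (simp add: t_def)
  have S: "(x, y) \<in> S" if "a \<le> x" "x \<le> a + t" "b \<le> y" "y \<le> b + t" for x y
  proof -
    have "x \<in> A" using t1(2) that by (auto simp: t_def dist_real_def subset_iff)
    moreover have "y \<in> C" using t2(2) that by (auto simp: t_def dist_real_def subset_iff)
    ultimately show ?thesis using AC(5) by blast
  qed
  then have SU: "(x, y) \<in> U" if "a \<le> x" "x \<le> a + t" "b \<le> y" "y \<le> b + t" for x y
    using that unfolding S_def by blast
  define \<Delta> where "\<Delta> = f (a + t, b + t) - f (a + t, b) - f (a, b + t) + f (a, b)"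
  have "\<exists>\<xi>>a. \<xi> < a + t \<and> (f (a + t, b + t) - f (a + t, b)) - (f (a, b + t) - f (a, b))
      = (a + t - a) * (fu (\<xi>, b + t) - fu (\<xi>, b))"
    using t by (intro MVT2 derivative_intros fu SU) auto
  then obtain \<xi> where \<xi>: "a < \<xi>" "\<xi> < a + t" "\<Delta> = t * (fu (\<xi>, b + t) - fu (\<xi>, b))"
    by (auto simp: \<Delta>_def)
  have "\<exists>\<eta>>b. \<eta> < b + t \<and> fu (\<xi>, b + t) - fu (\<xi>, b) = (b + t - b) * fuv (\<xi>, \<eta>)"
    using t \<xi> by (intro MVT2 fuv SU) auto
  then obtain \<eta> where \<eta>: "b < \<eta>" "\<eta> < b + t" "\<Delta> = t * (t * fuv (\<xi>, \<eta>))"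
    using \<xi>(3) by auto
  have "\<exists>\<eta>'>b. \<eta>' < b + t \<and> (f (a + t, b + t) - f (a, b + t)) - (f (a + t, b) - f (a, b))
      = (b + t - b) * (fv (a + t, \<eta>') - fv (a, \<eta>'))"
    using t by (intro MVT2 derivative_intros fv SU) auto
  then obtain \<eta>' where \<eta>': "b < \<eta>'" "\<eta>' < b + t" "\<Delta> = t * (fv (a + t, \<eta>') - fv (a, \<eta>'))"
    by (auto simp: \<Delta>_def)
  have "\<exists>\<xi>'>a. \<xi>' < a + t \<and> fv (a + t, \<eta>') - fv (a, \<eta>') = (a + t - a) * fvu (\<xi>', \<eta>')"
    using t \<eta>' by (intro MVT2 fvu SU) auto
  then obtain \<xi>' where \<xi>': "a < \<xi>'" "\<xi>' < a + t" "\<Delta> = t * (t * fvu (\<xi>', \<eta>'))"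
    using \<eta>'(3) by auto
  have "fuv (\<xi>, \<eta>) = fvu (\<xi>', \<eta>')"
    using \<eta>(3) \<xi>'(3) t by simp
  moreover have "\<bar>fuv (\<xi>, \<eta>) - fuv (a, b)\<bar> < \<bar>fuv (a, b) - fvu (a, b)\<bar> / 2"
    using S[of \<xi> \<eta>] \<xi> \<eta> by (simp add: S_def)
  moreover have "\<bar>fvu (\<xi>', \<eta>') - fvu (a, b)\<bar> < \<bar>fuv (a, b) - fvu (a, b)\<bar> / 2"
    using S[of \<xi>' \<eta>'] \<xi>' \<eta>' by (simp add: S_def)
  ultimately show False
    by argo
qed

lemma mixed_partials:
  fixes g :: "real \<times> real \<Rightarrow> 'a::euclidean_space"
  assumes U: "open U" "p \<in> U" and g: "smooth_on U g"
  shows "partial_v (partial_u g) p = partial_u (partial_v g) p"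
proof (rule euclidean_eqI)
  fix e :: 'a
  have u: "((\<lambda>x. h (x, y) \<bullet> e) has_real_derivative partial_u h (x, y) \<bullet> e) (at x)"
    and v: "((\<lambda>y. h (x, y) \<bullet> e) has_real_derivative partial_v h (x, y) \<bullet> e) (at y)"
    if "smooth_on U h" "(x, y) \<in> U" for h x y
  proof -
    note h = smooth_on_has_derivative[OF that]
    have "((\<lambda>x. h (x, y)) has_derivative (\<lambda>t. t *\<^sub>R partial_u h (x, y))) (at x)"
      using has_derivative_compose[where f = "\<lambda>x. (x, y)" and f' = "\<lambda>t. (t, 0)", OF _ h]
      by (simp add: has_derivative_Pair)
    then have "((\<lambda>x. h (x, y) \<bullet> e) has_derivative (\<lambda>t. t *\<^sub>R partial_u h (x, y) \<bullet> e)) (at x)"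
      by (rule has_derivative_inner_left)
    then show "((\<lambda>x. h (x, y) \<bullet> e) has_real_derivative partial_u h (x, y) \<bullet> e) (at x)"
      by (simp add: has_field_derivative_def mult_commute_abs)
    have "((\<lambda>y. h (x, y)) has_derivative (\<lambda>t. t *\<^sub>R partial_v h (x, y))) (at y)"
      using has_derivative_compose[where f = "\<lambda>y. (x, y)" and f' = "\<lambda>t. (0, t)", OF _ h]
      by (simp add: has_derivative_Pair)
    then have "((\<lambda>y. h (x, y) \<bullet> e) has_derivative (\<lambda>t. t *\<^sub>R partial_v h (x, y) \<bullet> e)) (at y)"
      by (rule has_derivative_inner_left)
    then show "((\<lambda>y. h (x, y) \<bullet> e) has_real_derivative partial_v h (x, y) \<bullet> e) (at y)"
      by (simp add: has_field_derivative_def mult_commute_abs)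
  qed
  note su = smooth_on_partial_u[OF g] and sv = smooth_on_partial_v[OF g]
  have "partial_v (partial_u g) (fst p, snd p) \<bullet> e = partial_u (partial_v g) (fst p, snd p) \<bullet> e"
    by (rule mixed_partials_real[OF U(1) _ u[OF g] v[OF g] v[OF su] u[OF sv],
          where a = "fst p" and b = "snd p"])
      (use U(2) smooth_on_continuous[OF smooth_on_partial_v[OF su]]
        smooth_on_continuous[OF smooth_on_partial_u[OF sv]] in \<open>auto intro!: continuous_intros\<close>)
  then show "partial_v (partial_u g) p \<bullet> e = partial_u (partial_v g) p \<bullet> e"
    by simp
qed

section \<open>Forms of signature (4,2)\<close>

text \<open>The counts 4 and 2 exhaust the six indices, so each \<open>B (e i) (e i)\<close> is a
  sign and its own inverse. Pairing a linear combination with \<open>e j\<close> then recovers its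
  coefficients, which yields both independence and the expansion.\<close>

lemma signature_4_2_orthonormal_basis:
  assumes "signature_4_2 B"
  obtains e :: "6 \<Rightarrow> real^6"
  where "\<And>i j. i \<noteq> j \<Longrightarrow> B (e i) (e j) = 0" "\<And>i. B (e i) (e i) * B (e i) (e i) = 1"
    "\<And>y. (\<Sum>i\<in>UNIV. (B (e i) (e i) * B y (e i)) *\<^sub>R e i) = y"
proof -
  obtain e :: "6 \<Rightarrow> real^6" where bil: "bilinear B" and orth: "\<And>i j. i \<noteq> j \<Longrightarrow> B (e i) (e j) = 0"
    and cards: "card {i. B (e i) (e i) = 1} = 4" "card {i. B (e i) (e i) = -1} = 2"
    using assms unfolding signature_4_2_def by blast
  have "card ({i. B (e i) (e i) = 1} \<union> {i. B (e i) (e i) = -1}) = CARD(6)"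
    by (subst card_Un_disjoint) (auto simp: cards)
  then have "{i. B (e i) (e i) = 1} \<union> {i. B (e i) (e i) = -1} = UNIV"
    by (intro card_subset_eq) auto
  then have one: "B (e i) (e i) * B (e i) (e i) = 1" for i
    by (metis (mono_tags, lifting) CollectD UNIV_I UnE mult_1_right square_eq_1_iff)
  have lin: "linear (\<lambda>y. B y z)" for z
    using bil by (simp add: bilinear_def)
  have Bsum: "B (\<Sum>i\<in>UNIV. u i *\<^sub>R e i) (e j) = u j * B (e j) (e j)" for u j
  proof -
    have "B (\<Sum>i\<in>UNIV. u i *\<^sub>R e i) (e j) = (\<Sum>i\<in>UNIV. u i * B (e i) (e j))"
      by (simp add: linear_sum[OF lin] linear_scale[OF lin])
    also have "\<dots> = (\<Sum>i\<in>UNIV. if i = j then u j * B (e j) (e j) else 0)"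
      by (rule sum.cong) (auto simp: orth)
    finally show ?thesis by simp
  qed
  have inj: "inj e"
    by (rule injI) (metis one orth mult_zero_left zero_neq_one)
  have ind: "independent (range e)"
  proof (rule independent_if_scalars_zero)
    fix h x assume "(\<Sum>x\<in>range e. h x *\<^sub>R x) = 0" "x \<in> range e"
    then obtain j where j: "x = e j" "(\<Sum>i\<in>UNIV. h (e i) *\<^sub>R e i) = 0"
      by (auto simp: sum.reindex[OF inj])
    have "h (e j) * B (e j) (e j) = 0"
      using Bsum[of "\<lambda>i. h (e i)" j] j(2) linear_0[OF lin] by simp
    then show "h x = 0"
      using one[of j] j(1) by auto
  qed simp
  have "card (range e) = 6"
    by (simp add: card_image[OF inj])
  then have "UNIV \<subseteq> span (range e)"
    by (intro card_ge_dim_independent ind) auto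
  then have "(\<Sum>i\<in>UNIV. (B (e i) (e i) * B y (e i)) *\<^sub>R e i) = y" for y
  proof -
    have "y \<in> range (\<lambda>u. \<Sum>v\<in>range e. u v *\<^sub>R v)"
      using \<open>UNIV \<subseteq> span (range e)\<close> span_finite[of "range e"] by auto
    then obtain u where u: "y = (\<Sum>i\<in>UNIV. u (e i) *\<^sub>R e i)"
      by (auto simp: sum.reindex[OF inj])
    have "B (e i) (e i) * B y (e i) = u (e i)" for i
      unfolding u Bsum using one[of i] by (simp add: mult.left_commute)
    then show ?thesis
      by (simp add: u)
  qed
  with orth one show thesis
    by (intro that) auto
qed

lemma signature_4_2_nondegenerate:
  assumes "signature_4_2 B" "\<And>c. B a c = 0"
  shows "a = 0"
proof -
  obtain e :: "6 \<Rightarrow> real^6" where "(\<Sum>i\<in>UNIV. (B (e i) (e i) * B a (e i)) *\<^sub>R e i) = a"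
    by (rule signature_4_2_orthonormal_basis[OF assms(1)]) blast
  then show ?thesis
    by (simp add: assms(2))
qed

lemma total_differential_orthogonal:
  assumes sig: "signature_4_2 B"
    and U: "open U" "connected U" "p0 \<in> U" "p \<in> U"
    and T0: "T p0 = id_blinfun"
    and der: "\<And>q. q \<in> U \<Longrightarrow> (T has_derivative (\<lambda>X. T q o\<^sub>L \<Phi> q X)) (at q)"
    and skew: "\<And>q X x y. q \<in> U \<Longrightarrow> B (\<Phi> q X x) y = - B (\<Phi> q X y) x"
  shows "T p \<in> orth_group B"
proof -
  obtain e :: "6 \<Rightarrow> real^6" where orth: "\<And>i j. i \<noteq> j \<Longrightarrow> B (e i) (e j) = 0"
    and one: "\<And>i. B (e i) (e i) * B (e i) (e i) = 1"
    and basis: "\<And>y. (\<Sum>i\<in>UNIV. (B (e i) (e i) * B y (e i)) *\<^sub>R e i) = y"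
    by (rule signature_4_2_orthonormal_basis[OF sig]) blast
  define \<epsilon> where "\<epsilon> i = B (e i) (e i)" for i
  note basis = basis[folded \<epsilon>_def]
  have bil: "bilinear B" and sym: "\<And>x y. B x y = B y x"
    using sig by (auto simp: signature_4_2_def)
  have bb: "bounded_bilinear B"
    using bil bilinear_conv_bounded_bilinear by blast
  interpret B: bounded_bilinear B by (rule bb)
  have TT: "(\<Sum>i\<in>UNIV. (\<epsilon> i * B y (T p (e i))) *\<^sub>R T p (e i)) = y" for y
  proof -
    \<comment> \<open>\<open>\<phi> q\<close> is \<open>T q\<close> composed with its \<open>B\<close>-adjoint, applied to \<open>y\<close>.\<close>
    define \<phi> where "\<phi> q = (\<Sum>i\<in>UNIV. (\<epsilon> i * B y (T q (e i))) *\<^sub>R T q (e i))" for q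
    have "(\<phi> has_derivative (\<lambda>X. 0)) (at q)" if q: "q \<in> U" for q
    proof -
      have "((\<lambda>q. T q (e i)) has_derivative (\<lambda>X. T q (\<Phi> q X (e i)))) (at q)" for i
        using bounded_linear.has_derivative[OF blinfun.bounded_linear_left der[OF q]] by simp
      then have "(\<phi> has_derivative (\<lambda>X. \<Sum>i\<in>UNIV. (\<epsilon> i * B y (T q (e i))) *\<^sub>R T q (\<Phi> q X (e i))
          + (\<epsilon> i * B y (T q (\<Phi> q X (e i)))) *\<^sub>R T q (e i))) (at q)"
        unfolding \<phi>_def
        by (intro has_derivative_sum has_derivative_scaleR has_derivative_mult_right
            bounded_linear.has_derivative[OF B.bounded_linear_right])
      moreover have "(\<Sum>i\<in>UNIV. (\<epsilon> i * B y (T q (e i))) *\<^sub>R T q (\<Phi> q X (e i))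
          + (\<epsilon> i * B y (T q (\<Phi> q X (e i)))) *\<^sub>R T q (e i)) = 0" (is "?S = 0") for X
      proof -
        define t where "t i = T q (e i)" for i
        \<comment> \<open>The coefficients \<open>a i j\<close> are antisymmetric because \<Phi> is
          skew, whereas the vectors that they multiply in the double sum are symmetric in i and j.
          The sum thus equals its own negative.\<close>
        define a where "a i j = \<epsilon> i * \<epsilon> j * B (\<Phi> q X (e i)) (e j)" for i j
        have T\<Phi>: "T q (\<Phi> q X (e i)) = (\<Sum>j\<in>UNIV. (\<epsilon> j * B (\<Phi> q X (e i)) (e j)) *\<^sub>R t j)" for i
        proof -
          have "T q (\<Sum>j\<in>UNIV. (\<epsilon> j * B (\<Phi> q X (e i)) (e j)) *\<^sub>R e j)
              = (\<Sum>j\<in>UNIV. (\<epsilon> j * B (\<Phi> q X (e i)) (e j)) *\<^sub>R t j)"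
            by (simp only: blinfun.sum_right blinfun.scaleR_right t_def)
          then show ?thesis
            by (simp only: basis)
        qed
        have 1: "(\<epsilon> i * B y (t i)) *\<^sub>R T q (\<Phi> q X (e i)) = (\<Sum>j\<in>UNIV. a i j *\<^sub>R B y (t i) *\<^sub>R t j)" for i
          unfolding T\<Phi> by (simp add: scaleR_sum_right a_def mult_ac)
        have 2: "(\<epsilon> i * B y (T q (\<Phi> q X (e i)))) *\<^sub>R t i = (\<Sum>j\<in>UNIV. a i j *\<^sub>R B y (t j) *\<^sub>R t i)" for i
          unfolding T\<Phi>
          by (simp add: B.sum_right B.scaleR_right sum_distrib_left scaleR_sum_left a_def mult_ac)
        have S: "?S = (\<Sum>i\<in>UNIV. \<Sum>j\<in>UNIV. a i j *\<^sub>R (B y (t i) *\<^sub>R t j + B y (t j) *\<^sub>R t i))"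
          unfolding t_def[symmetric] 1 2 scaleR_right_distrib sum.distrib ..
        also have "\<dots> = (\<Sum>j\<in>UNIV. \<Sum>i\<in>UNIV. a i j *\<^sub>R (B y (t i) *\<^sub>R t j + B y (t j) *\<^sub>R t i))"
          by (rule sum.swap)
        also have "\<dots> = (\<Sum>j\<in>UNIV. \<Sum>i\<in>UNIV. - (a j i *\<^sub>R (B y (t j) *\<^sub>R t i + B y (t i) *\<^sub>R t j)))"
        proof (intro sum.cong refl)
          fix i j
          have "a i j = - a j i"
            using skew[OF q, of X "e i" "e j"] by (simp add: a_def)
          then show "a i j *\<^sub>R (B y (t i) *\<^sub>R t j + B y (t j) *\<^sub>R t i)
              = - (a j i *\<^sub>R (B y (t j) *\<^sub>R t i + B y (t i) *\<^sub>R t j))"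
            by (simp add: add.commute)
        qed
        also have "\<dots> = - ?S"
          by (simp add: S sum_negf)
        finally have "?S = - ?S" .
        moreover have "x = 0" if "x = - x" for x :: "real^6"
          using that by (simp add: vec_eq_iff)
        ultimately show ?thesis by blast
      qed
      ultimately show ?thesis by simp
    qed
    then have "\<phi> p = \<phi> p0"
      using has_derivative_zero_unique_connected[OF U(1,2) _ U(4,3)] by blast
    then show ?thesis
      by (simp add: \<phi>_def T0 basis)
  qed
  define R where "R y = (\<Sum>i\<in>UNIV. (\<epsilon> i * B y (T p (e i))) *\<^sub>R e i)" for y
  \<comment> \<open>R is the \<open>B\<close>-adjoint of T(p). It is a right inverse by
    \<open>TT\<close>, and becomes a left inverse because a surjective endomorphism in finite
    dimension is injective.\<close>
  have TR: "T p (R y) = y" for y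
    unfolding R_def by (simp add: blinfun.sum_right blinfun.scaleR_right TT)
  then have "surj (blinfun_apply (T p))"
    by (metis surjI)
  then have "inj (blinfun_apply (T p))"
    by (intro linear_surjective_imp_injective bounded_linear.linear[OF blinfun.bounded_linear_right])
      simp_all
  then have RT: "R (T p z) = z" for z
    using TR[of "T p z"] by (simp add: inj_eq)
  have ez: "B z (e j) = B (T p z) (T p (e j))" for z j
  proof -
    have "B (R (T p z)) (e j) = (\<Sum>i\<in>UNIV. if i = j then B (T p z) (T p (e j)) else 0)"
      unfolding R_def B.sum_left B.scaleR_left
      by (rule sum.cong) (use one in \<open>auto simp: orth \<epsilon>_def algebra_simps\<close>)
    then show ?thesis
      by (simp add: RT)
  qed
  have "B (T p z) (T p x) = B z x" for z x
  proof -
    have "B (T p z) (T p x) = (\<Sum>i\<in>UNIV. \<epsilon> i * B x (e i) * B (T p z) (T p (e i)))"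
      by (subst basis[of x, symmetric]) (simp add: blinfun.sum_right blinfun.scaleR_right B.sum_right B.scaleR_right)
    also have "\<dots> = (\<Sum>i\<in>UNIV. \<epsilon> i * B x (e i) * B z (e i))"
      by (simp add: ez)
    also have "\<dots> = B z x"
      by (subst (2) basis[of x, symmetric]) (simp add: B.sum_right B.scaleR_right)
    finally show ?thesis .
  qed
  then show ?thesis
    by (simp add: orth_group_def)
qed

section \<open>Algebra of the wedge operators\<close>

lemma bounded_bilinear_wedge:
  assumes "bilinear B"
  shows "bounded_bilinear (wedge B)"
proof -
  have "bilinear (wedge B)"
    unfolding bilinear_def
    using assms by (auto intro!: linearI blinfun_eqI
        simp: wedge_apply bilinear_ladd bilinear_lmul blinfun.bilinear_simps algebra_simps)
  then show ?thesis
    using bilinear_conv_bounded_bilinear by blast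
qed

lemma wedge_self: "bilinear B \<Longrightarrow> wedge B a a = 0"
  by (rule blinfun_eqI) (simp add: wedge_apply)

lemma wedge_commute: "bilinear B \<Longrightarrow> wedge B a b = - wedge B b a"
  by (rule blinfun_eqI) (simp add: wedge_apply blinfun.bilinear_simps)

lemma wedge_skew:
  assumes "bilinear B" "\<And>x y. B x y = B y x"
  shows "B (wedge B a b x) y = - B (wedge B a b y) x"
  by (simp add: wedge_apply[OF assms(1)] bilinear_lsub[OF assms(1)] bilinear_lmul[OF assms(1)])

text \<open>Applied to c, each product equals -(s,c)(a,b) s, which is symmetric in a and b.\<close>

lemma wedge_null_commute:
  assumes bil: "bilinear B" and sym: "\<And>x y. B x y = B y x"
    and null: "B s s = 0" "B s a = 0" "B s b = 0"
  shows "wedge B s a o\<^sub>L wedge B s b = wedge B s b o\<^sub>L wedge B s a"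
proof (rule blinfun_eqI)
  fix c
  have "B a s = 0" "B b s = 0"
    using null sym by metis+
  then show "(wedge B s a o\<^sub>L wedge B s b) c = (wedge B s b o\<^sub>L wedge B s a) c"
    by (simp add: wedge_apply[OF bil] bilinear_rsub[OF bil] bilinear_rmul[OF bil] null sym[of b a])
qed

section \<open>Integrability of the Calapso system\<close>

text \<open>The 1-form P du + Q dv.\<close>

definition pair_form :: "'a::real_normed_vector \<Rightarrow> 'a \<Rightarrow> (real \<times> real) \<Rightarrow>\<^sub>L 'a" where
  "pair_form P Q = (blinfun_scaleR_left P o\<^sub>L fst_blinfun) + (blinfun_scaleR_left Q o\<^sub>L snd_blinfun)"

lemma pair_form_apply: "pair_form P Q X = fst X *\<^sub>R P + snd X *\<^sub>R Q"
  by (simp add: pair_form_def blinfun.add_left)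

lemma has_derivative_pair_form:
  assumes "(P has_derivative P') (at p)" "(Q has_derivative Q') (at p)"
  shows "((\<lambda>q. pair_form (P q) (Q q)) has_derivative (\<lambda>Y. pair_form (P' Y) (Q' Y))) (at p)"
proof -
  have "((\<lambda>q. blinfun_scaleR_left (F q) o\<^sub>L K) has_derivative (\<lambda>Y. blinfun_scaleR_left (F' Y) o\<^sub>L K)) (at p)"
    if "(F has_derivative F') (at p)" for F F' and K :: "(real \<times> real) \<Rightarrow>\<^sub>L real"
    by (intro bounded_linear.has_derivative[OF bounded_bilinear.bounded_linear_left[OF
            bounded_bilinear_blinfun_compose]]
        bounded_linear.has_derivative[OF bounded_linear_blinfun_scaleR_left] that)
  from has_derivative_add[OF this[OF assms(1)] this[OF assms(2)]]
  show ?thesis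
    unfolding pair_form_def .
qed

text \<open>Write \<mu> tau = P du + Q dv; the star puts the minus sign into Q. Then Q_u - P_v =
  -\<mu> (2 s ^ s_uv + s_u ^ s_v + s_v ^ s_u), where the last two terms cancel and the Moutard
  equation kills the first. Pointwise commutation holds since s is null and orthogonal to its
  derivatives.\<close>

lemma calapso_integrable:
  assumes sig: "signature_4_2 B"
    and U: "open U" "simply_connected U"
    and s: "smooth_on U s"
    and null: "\<And>p. p \<in> U \<Longrightarrow> B (s p) (s p) = 0"
      "\<And>p X. p \<in> U \<Longrightarrow> B (s p) (ext_deriv s p X) = 0"
    and moutard: "moutard_lift B U s"
  shows "\<exists>T. integrates B U \<mu> (tau_form B s) T"
\<comment> \<open>The integration starts at a base point, which the empty set does not have.\<close>
proof (cases "U = {}")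
  case True
  then show ?thesis by (simp add: integrates_def)
next
  case False
  have bil: "bilinear B" and sym: "\<And>x y. B x y = B y x"
    using sig by (auto simp: signature_4_2_def)
  interpret w: bounded_bilinear "wedge B"
    by (rule bounded_bilinear_wedge[OF bil])
  define D where "D g p Y = fst Y *\<^sub>R partial_u g p + snd Y *\<^sub>R partial_v g p"
    for g :: "real \<times> real \<Rightarrow> real^6" and p Y
  define P where "P p = \<mu> *\<^sub>R wedge B (s p) (partial_u s p)" for p
  define Q where "Q p = - (\<mu> *\<^sub>R wedge B (s p) (partial_v s p))" for p
  define P' where "P' p Y = \<mu> *\<^sub>R (wedge B (s p) (D (partial_u s) p Y) + wedge B (D s p Y) (partial_u s p))" for p Y
  define Q' where "Q' p Y = - (\<mu> *\<^sub>R (wedge B (s p) (D (partial_v s) p Y) + wedge B (D s p Y) (partial_v s p)))" for p Y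
  define W where "W p = pair_form (P p) (Q p)" for p
  define W' where "W' p Y = pair_form (P' p Y) (Q' p Y)" for p Y
  note su = smooth_on_partial_u[OF s] and sv = smooth_on_partial_v[OF s]
  have D: "(g has_derivative D g p) (at p)" if "smooth_on U g" "p \<in> U" for g p
    using smooth_on_has_derivative[OF that] unfolding D_def .
  have W: "W p X = \<mu> *\<^sub>R tau_form B s p X" if "p \<in> U" for p X
    by (simp add: W_def pair_form_apply P_def Q_def tau_form_def star_form_def
        ext_deriv_partials[OF smooth_on_differentiable[OF s that]] w.diff_right w.scaleR_right
        scaleR_right_diff_distrib mult.commute)
  obtain T p0 where T: "p0 \<in> U" "T p0 = id_blinfun"
    "\<And>p. p \<in> U \<Longrightarrow> (T has_derivative (\<lambda>X. T p o\<^sub>L W p X)) (at p)"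
  proof (rule total_differential_simply_connected[OF U False])
    fix p assume p: "p \<in> U"
    have "(P has_derivative P' p) (at p)"
      unfolding P_def P'_def by (intro has_derivative_scaleR_right w.FDERIV D p s su)
    moreover have "(Q has_derivative Q' p) (at p)"
      unfolding Q_def Q'_def by (intro has_derivative_scaleR_right has_derivative_minus w.FDERIV D p s sv)
    ultimately show "(W has_derivative W' p) (at p)"
      unfolding W_def W'_def by (rule has_derivative_pair_form)
    have mixed: "partial_u (partial_v s) p = partial_v (partial_u s) p"
      using mixed_partials[OF U(1) p s] by simp
    have m: "wedge B (s p) (partial_v (partial_u s) p) = 0"
      using moutard p by (simp add: moutard_lift_def)
    show "W' p Y X = W' p X Y" for X Y
      by (simp add: W'_def pair_form_apply P'_def Q'_def D_def w.add_left w.add_right w.scaleR_left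
          w.scaleR_right mixed m wedge_self[OF bil] wedge_commute[OF bil, of "partial_v s p" "partial_u s p"]
          algebra_simps)
    show "W p X o\<^sub>L W p Y = W p Y o\<^sub>L W p X" for X Y
      unfolding W[OF p] tau_form_def star_form_def w.scaleR_right[symmetric]
      by (rule wedge_null_commute[OF bil sym]) (simp_all add: null p bilinear_rmul[OF bil])
  next
    fix X Y
    show "continuous_on U (\<lambda>p. W' p Y X)"
      unfolding W'_def pair_form_apply P'_def Q'_def D_def
      by (intro continuous_intros w.continuous_on smooth_on_continuous s su sv
          smooth_on_partial_u smooth_on_partial_v)
  qed blast
  have "T p \<in> orth_group B" if "p \<in> U" for p
  proof (rule total_differential_orthogonal[OF sig U(1) simply_connected_imp_connected[OF U(2)] T(1) that T(2,3)])
    show "B (W q X x) y = - B (W q X y) x" if "q \<in> U" for q X x y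
      using wedge_skew[OF bil sym, of "s q" _ x y]
      by (simp add: W[OF that] tau_form_def blinfun.scaleR_left bilinear_lmul[OF bil])
  qed
  then have "integrates B U \<mu> (tau_form B s) T"
    using T(3) W by (simp add: integrates_def)
  then show ?thesis by blast
qed

section \<open>Aligned Moutard lifts\<close>

text \<open>Instead of solving for differentiable coefficients of h, a 3 x 3 determinant that
  vanishes wherever h lies in the span is differentiated. Let k be the component of h'(X) orthogonal
  to the span at p. As h(p) = 0 and k is orthogonal to s1(p), s2(p), only the term (k, h'(X)) times
  the Gram determinant of s1(p), s2(p) survives. Hence (k, h'(X)) = (k, k) = 0.\<close>

lemma derivative_in_span:
  fixes s1 s2 h :: "'e::real_normed_vector \<Rightarrow> 'f::euclidean_space"
  assumes U: "open U" "p \<in> U"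
    and der: "(h has_derivative h') (at p)" "s1 differentiable (at p)" "s2 differentiable (at p)"
    and span: "\<And>q. q \<in> U \<Longrightarrow> h q \<in> span {s1 q, s2 q}"
    and h0: "h p = 0"
    and indep: "s1 p \<notin> span {s2 p}" "s2 p \<noteq> 0"
  shows "h' X \<in> span {s1 p, s2 p}"
proof -
  obtain y k where y: "y \<in> span {s1 p, s2 p}" and k: "\<And>w. w \<in> span {s1 p, s2 p} \<Longrightarrow> orthogonal k w"
    and hX: "h' X = y + k"
    by (rule orthogonal_subspace_decomp_exists[of "{s1 p, s2 p}" "h' X"]) blast
  have k0: "k \<bullet> s1 p = 0" "k \<bullet> s2 p = 0" "k \<bullet> y = 0"
    using k y by (auto simp: orthogonal_def span_base)
  obtain s1' s2' where s: "(s1 has_derivative s1') (at p)" "(s2 has_derivative s2') (at p)"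
    using der unfolding differentiable_def by blast
  define m n where "m = s1 p" and "n = s2 p"
  define \<Delta> where "\<Delta> q = (m \<bullet> s1 q) * (n \<bullet> s2 q) - (n \<bullet> s1 q) * (m \<bullet> s2 q)" for q
  define G1 where "G1 q = (k \<bullet> s1 q) * (n \<bullet> s2 q) - (n \<bullet> s1 q) * (k \<bullet> s2 q)" for q
  define G2 where "G2 q = (k \<bullet> s1 q) * (m \<bullet> s2 q) - (m \<bullet> s1 q) * (k \<bullet> s2 q)" for q
  \<comment> \<open>\<open>F\<close> is the \<open>3 \<times> 3\<close> determinant of the pairings of \<open>h, s1, s2\<close> with \<open>k, s1 p, s2 p\<close>.\<close>
  define F where "F q = (k \<bullet> h q) * \<Delta> q - (m \<bullet> h q) * G1 q + (n \<bullet> h q) * G2 q" for q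
  have F0: "F q = 0" if q: "q \<in> U" for q
  proof -
    obtain a b where "h q = a *\<^sub>R s1 q + b *\<^sub>R s2 q"
      using span[OF q] by (auto simp: span_insert algebra_simps span_singleton)
    then show ?thesis
      by (simp add: F_def \<Delta>_def G1_def G2_def inner_add_right algebra_simps)
  qed
  have inner: "((\<lambda>q. v \<bullet> g q) has_derivative (\<lambda>Y. v \<bullet> g' Y)) (at p)"
    if "(g has_derivative g') (at p)" for v g g'
    by (rule has_derivative_inner_right[OF that])
  have "(\<lambda>q. v \<bullet> s1 q) differentiable (at p)" "(\<lambda>q. v \<bullet> s2 q) differentiable (at p)" for v
    using inner[OF s(1)] inner[OF s(2)] unfolding differentiable_def by blast+
  then have "\<Delta> differentiable (at p)" "G1 differentiable (at p)" "G2 differentiable (at p)"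
    unfolding \<Delta>_def G1_def G2_def by (intro differentiable_diff differentiable_mult; blast)+
  then obtain \<Delta>' G1' G2' where d: "(\<Delta> has_derivative \<Delta>') (at p)" "(G1 has_derivative G1') (at p)"
    "(G2 has_derivative G2') (at p)"
    unfolding differentiable_def by blast
  have prod: "((\<lambda>q. (v \<bullet> h q) * g q) has_derivative (\<lambda>Y. (v \<bullet> h' Y) * g p)) (at p)"
    if "(g has_derivative g') (at p)" for v g g'
    using has_derivative_mult[OF inner[OF der(1)] that] by (simp add: h0)
  have "G1 p = 0" "G2 p = 0"
    by (simp_all add: G1_def G2_def k0)
  then have "(F has_derivative (\<lambda>Y. (k \<bullet> h' Y) * \<Delta> p)) (at p)"
    using has_derivative_add[OF has_derivative_diff[OF prod[OF d(1), of k] prod[OF d(2), of m]] prod[OF d(3), of n]]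
    unfolding F_def by simp
  then have "((\<lambda>q. 0) has_derivative (\<lambda>Y. (k \<bullet> h' Y) * \<Delta> p)) (at p)"
    by (rule has_derivative_transform_within_open[OF _ U F0])
  then have "(\<lambda>Y. (k \<bullet> h' Y) * \<Delta> p) = (\<lambda>Y. 0)"
    by (rule has_derivative_unique) simp
  then have "(k \<bullet> h' X) * \<Delta> p = 0"
    by meson
  moreover have "\<Delta> p \<noteq> 0"
  proof
    assume "\<Delta> p = 0"
    \<comment> \<open>Up to the factor (n,n), w is the part of m orthogonal to n. Its square length
      is (n,n) times the Gram determinant, the equality case of Cauchy-Schwarz.\<close>
    define w where "w = (n \<bullet> n) *\<^sub>R m - (m \<bullet> n) *\<^sub>R n"
    have "w \<bullet> w = (n \<bullet> n) * \<Delta> p"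
      by (simp add: w_def \<Delta>_def m_def[symmetric] n_def[symmetric] inner_diff_left inner_diff_right
          inner_commute[of n m] algebra_simps)
    then have "(n \<bullet> n) *\<^sub>R m = (m \<bullet> n) *\<^sub>R n"
      using \<open>\<Delta> p = 0\<close> by (simp add: w_def)
    moreover have "n \<bullet> n \<noteq> 0"
      using indep by (simp add: n_def)
    ultimately have "m = ((m \<bullet> n) / (n \<bullet> n)) *\<^sub>R n"
      by (metis (no_types) divide_inverse_commute real_vector.scale_left_imp_eq scaleR_scaleR
          right_inverse scaleR_one)
    then show False
      using indep(1) unfolding m_def n_def by (metis span_base span_scale singletonI)
  qed
  ultimately have "k \<bullet> (y + k) = 0"
    using hX by simp
  then have "k = 0"
    using k0(3) by (simp add: inner_add_right)
  then show ?thesis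
    using y hX by simp
qed

text \<open>Nondegeneracy supplies c with (a,c) nonzero; evaluating the wedge at c solves for
  b.\<close>

lemma wedge_eq_0_span:
  assumes sig: "signature_4_2 B" and "wedge B a b = 0" "a \<noteq> 0"
  shows "b \<in> span {a}"
proof -
  obtain c where c: "B a c \<noteq> 0"
    using signature_4_2_nondegenerate[OF sig] assms(3) by blast
  have "B a c *\<^sub>R b - B b c *\<^sub>R a = 0"
    using wedge_apply[of B a b c] sig assms(2) by (simp add: signature_4_2_def)
  then have "b = (B b c / B a c) *\<^sub>R a"
    using c by (simp add: vector_fraction_eq_iff eq_commute[of b])
  then show ?thesis
    by (metis span_base span_scale singletonI)
qed

lemma span_pair_plane:
  fixes a b :: "'a::euclidean_space"
  assumes "subspace P" "dim P = 2" "a \<in> P" "b \<in> P" "a \<notin> span {b}" "b \<noteq> 0"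
  shows "P = span {a, b}"
proof -
  have "independent {a, b}"
    using assms(5,6) by (simp add: independent_insert)
  moreover have "a \<noteq> b"
    using assms(5) by (auto simp: span_base)
  ultimately have "dim (span {a, b}) = 2"
    by (simp add: dim_eq_card_independent)
  moreover have "span {a, b} \<subseteq> P"
    using assms by (intro span_minimal) auto
  ultimately show ?thesis
    using subspace_dim_equal[of "span {a, b}" P] assms(1,2) by simp
qed

lemma partials_combination:
  assumes U: "open U" "p \<in> U" and s: "smooth_on U s1" "smooth_on U s2"
    and g: "\<And>q. q \<in> U \<Longrightarrow> g q = s1 q + c *\<^sub>R s2 q"
  shows "partial_u g p = partial_u s1 p + c *\<^sub>R partial_u s2 p"
    and "partial_v g p = partial_v s1 p + c *\<^sub>R partial_v s2 p"
proof -
  have "((\<lambda>q. s1 q + c *\<^sub>R s2 q) has_derivative (\<lambda>X. (fst X *\<^sub>R partial_u s1 p + snd X *\<^sub>R partial_v s1 p)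
      + c *\<^sub>R (fst X *\<^sub>R partial_u s2 p + snd X *\<^sub>R partial_v s2 p))) (at p)"
    by (intro has_derivative_add has_derivative_scaleR_right smooth_on_has_derivative[OF s(1) U(2)]
        smooth_on_has_derivative[OF s(2) U(2)])
  from has_derivative_transform_within_open[OF this U g[symmetric]]
  have "ext_deriv g p X = (fst X *\<^sub>R partial_u s1 p + snd X *\<^sub>R partial_v s1 p)
      + c *\<^sub>R (fst X *\<^sub>R partial_u s2 p + snd X *\<^sub>R partial_v s2 p)" for X
    by (rule ext_deriv_eqI)
  then show "partial_u g p = partial_u s1 p + c *\<^sub>R partial_u s2 p"
    "partial_v g p = partial_v s1 p + c *\<^sub>R partial_v s2 p"
    by (simp_all add: partial_u_def[of g] partial_v_def[of g])
qed

lemma second_partials_combination: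
  assumes U: "open U" "p \<in> U" and s: "smooth_on U s1" "smooth_on U s2"
    and g: "\<And>q. q \<in> U \<Longrightarrow> g q = s1 q + c *\<^sub>R s2 q"
  shows "partial_v (partial_u g) p = partial_v (partial_u s1) p + c *\<^sub>R partial_v (partial_u s2) p"
  using partials_combination(1)[OF U(1) _ s g]
  by (intro partials_combination(2)[OF U] smooth_on_partial_u s)

lemma aligned_curvature_lifts:
  assumes sig: "signature_4_2 B" and U: "open U" "p \<in> U"
    and f: "legendre_map B U f"
    and lifts: "curvature_line_lifts U f s1 s2"
    and sp: "moutard_lift B U sp" "\<And>q. q \<in> U \<Longrightarrow> sp q = s1 q + s2 q"
    and sm: "moutard_lift B U sm" "\<And>q. q \<in> U \<Longrightarrow> sm q = s1 q - s2 q"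
  shows "wedge B (s2 p) (partial_u s1 p) = 0" "wedge B (s1 p) (partial_v s2 p) = 0"
proof -
  have s: "smooth_on U s1" "smooth_on U s2"
    and sf: "\<And>q. q \<in> U \<Longrightarrow> s1 q \<in> f q" "\<And>q. q \<in> U \<Longrightarrow> s2 q \<in> f q"
    and s0: "\<And>q. q \<in> U \<Longrightarrow> s1 q \<noteq> 0" "\<And>q. q \<in> U \<Longrightarrow> s2 q \<noteq> 0"
    and ne: "\<And>q. q \<in> U \<Longrightarrow> span {s1 q} \<noteq> span {s2 q}"
    and curv: "\<And>q. q \<in> U \<Longrightarrow> partial_u s1 q \<in> f q" "\<And>q. q \<in> U \<Longrightarrow> partial_v s2 q \<in> f q"
    using lifts unfolding curvature_line_lifts_def envelops_def section_over_def by blast+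
  have fsub: "subspace (f q)" and fdim: "dim (f q) = 2" if "q \<in> U" for q
    using f[unfolded legendre_map_def, THEN conjunct1] that unfolding null_plane_def by blast+
  have indep: "s1 q \<notin> span {s2 q}" if "q \<in> U" for q
  proof
    assume "s1 q \<in> span {s2 q}"
    then obtain c where c: "s1 q = c *\<^sub>R s2 q"
      by (auto simp: span_singleton)
    then have "c \<noteq> 0"
      using s0(1)[OF that] by auto
    then have "span {s1 q} = span {s2 q}"
      unfolding c by (intro span_image_scale[of "{s2 q}" "\<lambda>_. c", simplified])
    with ne[OF that] show False ..
  qed
  have fspan: "f q = span {s1 q, s2 q}" if "q \<in> U" for q
    using that by (intro span_pair_plane fsub fdim sf indep s0)
  \<comment> \<open>Modulo \<open>f p\<close> the derivative of a section depends only on its value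
    at p: subtracting the combination of s1, s2 with constant coefficients a, b leaves a section of
    f that vanishes at p.\<close>
  have deriv_mod_f: "ext_deriv \<sigma> p X - a *\<^sub>R ext_deriv s1 p X - b *\<^sub>R ext_deriv s2 p X \<in> f p"
    if V: "open V" "p \<in> V" "V \<subseteq> U" and \<sigma>: "section_over f V \<sigma>" and ab: "\<sigma> p = a *\<^sub>R s1 p + b *\<^sub>R s2 p"
    for V \<sigma> a b X
  proof -
    have diff: "g differentiable (at p) \<Longrightarrow> (g has_derivative ext_deriv g p) (at p)"
      for g :: "real \<times> real \<Rightarrow> real^6"
      unfolding ext_deriv_def by (simp add: frechet_derivative_works)
    have d: "s1 differentiable (at p)" "s2 differentiable (at p)" "\<sigma> differentiable (at p)"
      using smooth_on_differentiable[OF s(1) U(2)] smooth_on_differentiable[OF s(2) U(2)]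
        \<sigma> smooth_on_differentiable[OF _ V(2)] unfolding section_over_def by blast+
    have "((\<lambda>q. \<sigma> q - a *\<^sub>R s1 q - b *\<^sub>R s2 q) has_derivative
        (\<lambda>X. ext_deriv \<sigma> p X - a *\<^sub>R ext_deriv s1 p X - b *\<^sub>R ext_deriv s2 p X)) (at p)"
      by (intro has_derivative_diff has_derivative_scaleR_right diff d)
    moreover have "\<sigma> q - a *\<^sub>R s1 q - b *\<^sub>R s2 q \<in> span {s1 q, s2 q}" if "q \<in> V" for q
    proof -
      have "\<sigma> q \<in> f q" "q \<in> U"
        using \<sigma> V(3) that unfolding section_over_def by auto
      then show ?thesis
        unfolding fspan[OF \<open>q \<in> U\<close>] by (intro span_diff span_scale) (auto simp: span_base)
    qed
    ultimately show ?thesis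
      unfolding fspan[OF U(2)]
      by (rule derivative_in_span[OF V(1,2) _ d(1,2)]) (simp_all add: ab indep U s0)
  qed
  \<comment> \<open>The immersion condition speaks of all local sections; by the previous step it
    suffices to test s1 and s2.\<close>
  have immersion: "X = 0" if X: "ext_deriv s1 p X \<in> f p" "ext_deriv s2 p X \<in> f p" for X
  proof -
    have "ext_deriv \<sigma> p X \<in> f p"
      if V: "open V" "p \<in> V" "V \<subseteq> U" and \<sigma>: "section_over f V \<sigma>" for V \<sigma>
    proof -
      have "\<sigma> p \<in> f p"
        using \<sigma> V(2) unfolding section_over_def by blast
      then obtain a b where "\<sigma> p = a *\<^sub>R s1 p + b *\<^sub>R s2 p"
        unfolding fspan[OF U(2)] by (auto simp: span_insert algebra_simps span_singleton)
      from deriv_mod_f[OF V \<sigma> this, of X]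
      have "(ext_deriv \<sigma> p X - a *\<^sub>R ext_deriv s1 p X - b *\<^sub>R ext_deriv s2 p X)
          + b *\<^sub>R ext_deriv s2 p X + a *\<^sub>R ext_deriv s1 p X \<in> f p"
        by (intro subspace_add subspace_scale fsub U(2) X)
      then show ?thesis by simp
    qed
    with f[unfolded legendre_map_def, THEN conjunct2, THEN conjunct2, THEN conjunct2, THEN bspec, OF U(2)]
    show ?thesis by blast
  qed
  have plus: "partial_v (partial_u sp) p = partial_v (partial_u s1) p + partial_v (partial_u s2) p"
    using second_partials_combination[OF U s, of sp 1] sp(2) by simp
  have minus: "partial_v (partial_u sm) p = partial_v (partial_u s1) p - partial_v (partial_u s2) p"
    using second_partials_combination[OF U s, of sm "-1"] sm(2) by simp
  have mix: "partial_v (partial_u g) p \<in> f p"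
    if "moutard_lift B U g" "g p \<in> f p" "g p \<noteq> 0" for g
  proof -
    have "partial_v (partial_u g) p \<in> span {g p}"
      using wedge_eq_0_span[OF sig _ that(3)] that(1) U(2) by (simp add: moutard_lift_def)
    moreover have "span {g p} \<subseteq> f p"
      using that(2) fsub[OF U(2)] by (intro span_minimal) auto
    ultimately show ?thesis by blast
  qed
  have "sp p \<noteq> 0"
    using indep[OF U(2)] sp(2)[OF U(2)]
    by (metis add.inverse_unique add.commute scaleR_minus1_left span_base span_scale singletonI)
  moreover have "sm p \<noteq> 0"
    using indep[OF U(2)] sm(2)[OF U(2)] by (auto simp: span_base)
  moreover have "sp p \<in> f p" "sm p \<in> f p"
    unfolding sp(2)[OF U(2)] sm(2)[OF U(2)]
    by (intro subspace_add subspace_diff fsub[OF U(2)] sf U(2))+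
  ultimately have "partial_v (partial_u sp) p \<in> f p" "partial_v (partial_u sm) p \<in> f p"
    using mix sp(1) sm(1) by blast+
  \<comment> \<open>Half the sum and half the difference of the two Moutard equations isolate s1_uv
    and s2_uv.\<close>
  then have "(1/2) *\<^sub>R (partial_v (partial_u sp) p + partial_v (partial_u sm) p) \<in> f p"
    "(1/2) *\<^sub>R (partial_v (partial_u sp) p - partial_v (partial_u sm) p) \<in> f p"
    using fsub[OF U(2)] by (blast intro: subspace_add subspace_diff subspace_scale)+
  then have s1uv: "partial_v (partial_u s1) p \<in> f p" and s2uv: "partial_v (partial_u s2) p \<in> f p"
    unfolding plus minus by (simp_all add: scaleR_2[symmetric])
  have s2vu: "partial_u (partial_v s2) p \<in> f p"
    using s2uv mixed_partials[OF U s(2)] by simp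
  \<comment> \<open>Since s2_v lies in f, having s1_v in f too would make the v-direction violate
    the immersion condition. The next claim is the same for the u-direction.\<close>
  have s1v: "partial_v s1 p \<notin> f p"
    using immersion[of "(0, 1)"] curv(2)[OF U(2)] by (auto simp: partial_v_def zero_prod_def)
  have s2u: "partial_u s2 p \<notin> f p"
    using immersion[of "(1, 0)"] curv(1)[OF U(2)] by (auto simp: partial_u_def zero_prod_def)
  obtain a b where ab: "partial_u s1 p = a *\<^sub>R s1 p + b *\<^sub>R s2 p"
    using curv(1)[OF U(2)] unfolding fspan[OF U(2)] by (auto simp: span_insert algebra_simps span_singleton)
  obtain c d where cd: "partial_v s2 p = c *\<^sub>R s1 p + d *\<^sub>R s2 p"
    using curv(2)[OF U(2)] unfolding fspan[OF U(2)] by (auto simp: span_insert algebra_simps span_singleton)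
  \<comment> \<open>s1_u and s2_v are sections of f themselves, so they can be differentiated modulo
    f; of the coefficients a, b, c, d only the values at p enter.\<close>
  have "section_over f U (partial_u s1)" "section_over f U (partial_v s2)"
    using s curv by (auto simp: section_over_def smooth_on_partial_u smooth_on_partial_v)
  note deriv_mod_f[OF U(1,2) order_refl this(1) ab, of "(0, 1)", folded partial_v_def]
    deriv_mod_f[OF U(1,2) order_refl this(2) cd, of "(1, 0)", folded partial_u_def]
  note mod_f = this
  have "partial_v (partial_u s1) p - b *\<^sub>R partial_v s2 p
      - (partial_v (partial_u s1) p - a *\<^sub>R partial_v s1 p - b *\<^sub>R partial_v s2 p) \<in> f p"
    by (intro subspace_diff[OF fsub[OF U(2)]] subspace_scale[OF fsub[OF U(2)]] mod_f s1uv curv U)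
  then have "a *\<^sub>R partial_v s1 p \<in> f p"
    by (simp add: algebra_simps)
  then have "a = 0"
    using s1v subspace_scale[OF fsub[OF U(2)], of "a *\<^sub>R partial_v s1 p" "1 / a"] by (auto split: if_splits)
  have "partial_u (partial_v s2) p - c *\<^sub>R partial_u s1 p
      - (partial_u (partial_v s2) p - c *\<^sub>R partial_u s1 p - d *\<^sub>R partial_u s2 p) \<in> f p"
    by (intro subspace_diff[OF fsub[OF U(2)]] subspace_scale[OF fsub[OF U(2)]] mod_f s2vu curv U)
  then have "d *\<^sub>R partial_u s2 p \<in> f p"
    by (simp add: algebra_simps)
  then have "d = 0"
    using s2u subspace_scale[OF fsub[OF U(2)], of "d *\<^sub>R partial_u s2 p" "1 / d"] by (auto split: if_splits)
  have bil: "bilinear B"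
    using sig by (simp add: signature_4_2_def)
  have "wedge B x (t *\<^sub>R x) = 0" for x t
    by (rule blinfun_eqI) (simp add: wedge_apply[OF bil] bilinear_lmul[OF bil])
  then show "wedge B (s2 p) (partial_u s1 p) = 0" "wedge B (s1 p) (partial_v s2 p) = 0"
    by (simp_all add: ab cd \<open>a = 0\<close> \<open>d = 0\<close>)
qed

section \<open>The transformations of the contact elements\<close>

text \<open>The images of N, tau+ and dN lie in the span of s+, s- and their first derivatives, all
  orthogonal to f. Since N pairs its argument with s+ and s- only, it kills these images; tau+ N
  vanishes as the image of N lies in f. With N^2 = 0 the factor 1 + cN is exp(cN), the exponential
  of a skew map, hence orthogonal.\<close>

lemma wedge_plane_transformation:
  assumes sig: "signature_4_2 B"
    and s: "smooth_on U sp" "smooth_on U sm" and p: "p \<in> U"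
    and null: "B (sp p) (sp p) = 0" "B (sp p) (sm p) = 0" "B (sm p) (sm p) = 0"
      "\<And>X. B (sp p) (ext_deriv sp p X) = 0" "\<And>X. B (sp p) (ext_deriv sm p X) = 0"
      "\<And>X. B (sm p) (ext_deriv sp p X) = 0" "\<And>X. B (sm p) (ext_deriv sm p X) = 0"
    and T: "integrates B U \<mu> (tau_form B sp) T"
  shows "T p o\<^sub>L (id_blinfun + c *\<^sub>R wedge B (sp p) (sm p)) \<in> orth_group B"
    and "((\<lambda>q. T q o\<^sub>L (id_blinfun + c *\<^sub>R wedge B (sp q) (sm q))) has_derivative
      (\<lambda>X. (T p o\<^sub>L (id_blinfun + c *\<^sub>R wedge B (sp p) (sm p))) o\<^sub>L
        (\<mu> *\<^sub>R tau_form B sp p X + c *\<^sub>R ext_deriv (\<lambda>q. wedge B (sp q) (sm q)) p X))) (at p)"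
proof -
  have bil: "bilinear B" and sym: "\<And>x y. B x y = B y x"
    using sig by (auto simp: signature_4_2_def)
  interpret w: bounded_bilinear "wedge B"
    by (rule bounded_bilinear_wedge[OF bil])
  note wedge = wedge_apply[OF bil]
  note bilin = bilinear_ladd[OF bil] bilinear_radd[OF bil] bilinear_lsub[OF bil] bilinear_rsub[OF bil]
    bilinear_lmul[OF bil] bilinear_rmul[OF bil]
  have flipped: "B (sm p) (sp p) = 0" "B (ext_deriv sp p X) (sp p) = 0" "B (ext_deriv sm p X) (sp p) = 0"
    "B (ext_deriv sp p X) (sm p) = 0" "B (ext_deriv sm p X) (sm p) = 0" for X
    using null sym by metis+
  note null' = null flipped
  define N where "N q = wedge B (sp q) (sm q)" for q
  define dN where "dN X = wedge B (sp p) (ext_deriv sm p X) + wedge B (ext_deriv sp p X) (sm p)" for X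
  have diff: "smooth_on U g \<Longrightarrow> (g has_derivative ext_deriv g p) (at p)" for g :: "real \<times> real \<Rightarrow> real^6"
    unfolding ext_deriv_def using smooth_on_differentiable p by (metis frechet_derivative_works)
  have N: "(N has_derivative dN) (at p)"
    unfolding N_def dN_def by (intro w.FDERIV diff s)
  then have ext: "ext_deriv N p X = dN X" for X
    by (rule ext_deriv_eqI)
  have \<tau>N: "tau_form B sp p X (N p y) = 0" for X y
    by (simp add: tau_form_def star_form_def N_def wedge bilin null')
  have N\<tau>: "N p (tau_form B sp p X y) = 0" for X y
    by (simp add: tau_form_def star_form_def N_def wedge bilin null')
  have NdN: "N p (dN X y) = 0" for X y
    by (simp add: dN_def N_def blinfun.add_left wedge bilin null')
  have NN: "N p (N p y) = 0" for y
    by (simp add: N_def wedge bilin null')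
  have T': "(T has_derivative (\<lambda>X. T p o\<^sub>L \<mu> *\<^sub>R tau_form B sp p X)) (at p)"
    and To: "B (T p x) (T p y) = B x y" for x y
    using T p by (auto simp: integrates_def orth_group_def)
  have "B (N p x) y = - B x (N p y)" for x y
    using wedge_skew[OF bil sym, of "sp p" "sm p" x y] sym by (simp add: N_def)
  then show "T p o\<^sub>L (id_blinfun + c *\<^sub>R wedge B (sp p) (sm p)) \<in> orth_group B"
    unfolding N_def[symmetric] orth_group_def
    by (simp add: To blinfun.add_left blinfun.scaleR_left bilin NN bilinear_rzero[OF bil])
  have "((\<lambda>q. T q o\<^sub>L (id_blinfun + c *\<^sub>R N q)) has_derivative
      (\<lambda>X. (T p o\<^sub>L (0 + c *\<^sub>R dN X)) + (T p o\<^sub>L \<mu> *\<^sub>R tau_form B sp p X o\<^sub>L (id_blinfun + c *\<^sub>R N p)))) (at p)"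
    by (intro bounded_bilinear.FDERIV[OF bounded_bilinear_blinfun_compose] T' has_derivative_add
        has_derivative_const has_derivative_scaleR_right N)
  moreover have "(T p o\<^sub>L (0 + c *\<^sub>R dN X)) + (T p o\<^sub>L \<mu> *\<^sub>R tau_form B sp p X o\<^sub>L (id_blinfun + c *\<^sub>R N p))
      = (T p o\<^sub>L (id_blinfun + c *\<^sub>R N p)) o\<^sub>L (\<mu> *\<^sub>R tau_form B sp p X + c *\<^sub>R dN X)" for X
    by (rule blinfun_eqI) (simp add: blinfun.bilinear_simps \<tau>N N\<tau> NdN)
  ultimately show "((\<lambda>q. T q o\<^sub>L (id_blinfun + c *\<^sub>R wedge B (sp q) (sm q))) has_derivative
      (\<lambda>X. (T p o\<^sub>L (id_blinfun + c *\<^sub>R wedge B (sp p) (sm p))) o\<^sub>L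
        (\<mu> *\<^sub>R tau_form B sp p X + c *\<^sub>R ext_deriv (\<lambda>q. wedge B (sp q) (sm q)) p X))) (at p)"
    unfolding N_def[symmetric] ext by simp
qed

text \<open>With s+ and s- written as s1 + s2 and s1 - s2, N = -2 s1 ^ s2, and tau- - tau+ - dN
  works out to -4 s2 ^ s1_u du + 4 s1 ^ s2_v dv. The two wedges in \<open>curv\<close> are therefore
  the exact obstruction.\<close>

lemma tau_form_difference:
  assumes bil: "bilinear B" and U: "open U" "p \<in> U" and s: "smooth_on U s1" "smooth_on U s2"
    and smooth: "smooth_on U sp" "smooth_on U sm"
    and sp: "\<And>q. q \<in> U \<Longrightarrow> sp q = s1 q + s2 q" and sm: "\<And>q. q \<in> U \<Longrightarrow> sm q = s1 q - s2 q"
    and curv: "wedge B (s2 p) (partial_u s1 p) = 0" "wedge B (s1 p) (partial_v s2 p) = 0"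
  shows "tau_form B sm p X = tau_form B sp p X + ext_deriv (\<lambda>q. wedge B (sp q) (sm q)) p X"
proof -
  interpret w: bounded_bilinear "wedge B"
    by (rule bounded_bilinear_wedge[OF bil])
  have dsp: "ext_deriv sp p X = fst X *\<^sub>R (partial_u s1 p + partial_u s2 p)
      + snd X *\<^sub>R (partial_v s1 p + partial_v s2 p)" for X
    using partials_combination[OF U s, of sp 1] sp
    by (simp add: ext_deriv_partials[OF smooth_on_differentiable[OF smooth(1) U(2)]])
  have dsm: "ext_deriv sm p X = fst X *\<^sub>R (partial_u s1 p - partial_u s2 p)
      + snd X *\<^sub>R (partial_v s1 p - partial_v s2 p)" for X
    using partials_combination[OF U s, of sm "-1"] sm
    by (simp add: ext_deriv_partials[OF smooth_on_differentiable[OF smooth(2) U(2)]])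
  have diff: "smooth_on U g \<Longrightarrow> (g has_derivative ext_deriv g p) (at p)" for g :: "real \<times> real \<Rightarrow> real^6"
    unfolding ext_deriv_def using smooth_on_differentiable U(2) by (metis frechet_derivative_works)
  have "ext_deriv (\<lambda>q. wedge B (sp q) (sm q)) p X
      = wedge B (sp p) (ext_deriv sm p X) + wedge B (ext_deriv sp p X) (sm p)"
    by (rule ext_deriv_eqI) (intro w.FDERIV diff smooth)
  moreover have "wedge B (partial_u s1 p) (s2 p) = 0" "wedge B (partial_v s2 p) (s1 p) = 0"
    using curv wedge_commute[OF bil] by (metis neg_0_equal_iff_equal)+
  moreover note wedge_commute[OF bil, of "partial_u s1 p" "s1 p"] wedge_commute[OF bil, of "partial_v s1 p" "s1 p"]
    wedge_commute[OF bil, of "partial_u s2 p" "s1 p"] wedge_commute[OF bil, of "partial_u s2 p" "s2 p"]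
    wedge_commute[OF bil, of "partial_v s1 p" "s2 p"] wedge_commute[OF bil, of "partial_v s2 p" "s2 p"]
  ultimately show ?thesis
    by (simp add: tau_form_def star_form_def dsp dsm sp[OF U(2)] sm[OF U(2)] w.add_left w.add_right
        w.diff_left w.diff_right w.scaleR_left w.scaleR_right curv algebra_simps scaleR_2[symmetric])
qed

theorem mainTheorem2:
  fixes B :: "real^6 \<Rightarrow> real^6 \<Rightarrow> real"
    and U :: "(real \<times> real) set"
    and f :: "real \<times> real \<Rightarrow> (real^6) set"
    and sp sm :: "real \<times> real \<Rightarrow> real^6"
  assumes "signature_4_2 B"
    and "open U" and "simply_connected U"
    and "omega_surface B U f sp sm"
    and "aligned_moutard_lifts B U f sp sm"
  shows "\<exists>T Tp Tm.
           lie_deformation_transformation B U sp sm T \<and>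
           calapso_transformation B U sp Tp \<and>
           calapso_transformation B U sm Tm \<and>
           (\<forall>\<mu>. \<forall>p\<in>U.
              blinfun_apply (T \<mu> p) ` f p = blinfun_apply (Tp \<mu> p) ` f p \<and>
              blinfun_apply (Tp \<mu> p) ` f p = blinfun_apply (Tm \<mu> p) ` f p)"
proof -
  have bil: "bilinear B"
    using assms(1) by (simp add: signature_4_2_def)
  have legendre: "legendre_map B U f" and env: "envelops U f sp" "envelops U f sm"
    using assms(4) unfolding omega_surface_def isothermic_def by blast+
  obtain s1 s2 where moutard: "moutard_lift B U sp" "moutard_lift B U sm"
    and lifts: "curvature_line_lifts U f s1 s2"
    and sp: "\<And>q. q \<in> U \<Longrightarrow> sp q = s1 q + s2 q" and sm: "\<And>q. q \<in> U \<Longrightarrow> sm q = s1 q - s2 q"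
    using assms(5) unfolding aligned_moutard_lifts_def by blast
  have sec: "section_over f U sp" "section_over f U sm" "section_over f U s1" "section_over f U s2"
    using env lifts unfolding curvature_line_lifts_def envelops_def by blast+
  then have smooth: "smooth_on U sp" "smooth_on U sm" "smooth_on U s1" "smooth_on U s2"
    and mem: "\<And>p. p \<in> U \<Longrightarrow> sp p \<in> f p" "\<And>p. p \<in> U \<Longrightarrow> sm p \<in> f p"
    by (auto simp: section_over_def)
  have null: "B x y = 0" if "p \<in> U" "x \<in> f p" "y \<in> f p" for p x y
    using legendre[unfolded legendre_map_def, THEN conjunct1] that unfolding null_plane_def by blast
  have contact: "B (s p) (ext_deriv s' p X) = 0"
    if "p \<in> U" "section_over f U s" "section_over f U s'" for s s' p X
  proof -
    have "B (ext_deriv s' p X) (s p) = 0"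
      using legendre[unfolded legendre_map_def, THEN conjunct2, THEN conjunct2, THEN conjunct1] assms(2) that
      by blast
    then show ?thesis
      using assms(1) by (simp add: signature_4_2_def)
  qed
  have "\<exists>T. integrates B U \<mu> (tau_form B sp) T" for \<mu>
    using moutard(1) null mem contact[OF _ sec(1) sec(1)]
    by (intro calapso_integrable[OF assms(1-3) smooth(1)]) auto
  then obtain Tp where Tp: "\<And>\<mu>. integrates B U \<mu> (tau_form B sp) (Tp \<mu>)"
    by metis
  \<comment> \<open>This is where the constants of integration are chosen: at the point where the
    solution for tau+ is the identity, \<open>Tc\<close> has the value 1 + cN. Normalising all three
    solutions to the identity at a common point would in general introduce a constant factor from
    the left.\<close>
  define Tc where "Tc \<mu> c p = Tp \<mu> p o\<^sub>L (id_blinfun + c *\<^sub>R wedge B (sp p) (sm p))" for \<mu> c p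
  have orth: "Tc \<mu> c p \<in> orth_group B"
    and deriv: "(Tc \<mu> c has_derivative (\<lambda>X. Tc \<mu> c p o\<^sub>L
        (\<mu> *\<^sub>R tau_form B sp p X + c *\<^sub>R ext_deriv (\<lambda>q. wedge B (sp q) (sm q)) p X))) (at p)"
    if "p \<in> U" for \<mu> c p
    unfolding Tc_def
    by (rule wedge_plane_transformation[OF assms(1) smooth(1,2) that _ _ _ _ _ _ _ Tp];
        intro null[OF that] mem[OF that] contact[OF that] sec)+
  have image: "Tc \<mu> c p ` f p = Tp \<mu> p ` f p" if "p \<in> U" for \<mu> c p
    by (rule image_cong)
      (simp_all add: Tc_def blinfun.add_left blinfun.scaleR_left wedge_apply[OF bil] null[OF that mem(1)[OF that]]
        null[OF that mem(2)[OF that]])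
  have "lie_deformation_transformation B U sp sm (\<lambda>\<mu>. Tc \<mu> (\<mu> / 2))"
    unfolding lie_deformation_transformation_def integrates_def tau_mid_def
    using orth deriv[where c = "\<mu> / 2" and \<mu> = \<mu> for \<mu>] by (simp add: scaleR_right_distrib)
  moreover have "calapso_transformation B U sp Tp"
    using Tp by (simp add: calapso_transformation_def)
  moreover have "calapso_transformation B U sm (\<lambda>\<mu>. Tc \<mu> \<mu>)"
  proof -
    have "tau_form B sm p X = tau_form B sp p X + ext_deriv (\<lambda>q. wedge B (sp q) (sm q)) p X"
      if "p \<in> U" for p X
      using aligned_curvature_lifts[OF assms(1,2) that legendre lifts moutard(1) sp moutard(2) sm]
      by (intro tau_form_difference[OF bil assms(2) that smooth(3,4,1,2) sp sm])
    then show ?thesis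
      unfolding calapso_transformation_def integrates_def
      using orth deriv[where c = \<mu> and \<mu> = \<mu> for \<mu>] by (simp add: scaleR_right_distrib)
  qed
  moreover have "\<forall>\<mu>. \<forall>p\<in>U. Tc \<mu> (\<mu> / 2) p ` f p = Tp \<mu> p ` f p \<and> Tp \<mu> p ` f p = Tc \<mu> \<mu> p ` f p"
    by (simp add: image)
  ultimately show ?thesis
    by (intro exI conjI)
qed

end
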